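(* Let $\alpha^*,\tau_1^*,\tau_\infty^*,\beta_1^*,\beta_2^*,\beta_3^*$ be the constants in the context and let $\widehat J^*$ be the optimal value of problem (R) in the context. Assume that problem (Q) in the context satisfies $$x_{f4}-x_{0,4}\ \ge\ -\frac{x_{0,1}}{M_0}\left(\frac{x_{0,1}^3}{M_0^2}\widehat J^*+M_3\tau_\infty^*\right).$$ Then chattering occurs in the optimal solution of (Q), as follows. 1. For every $i\in\{0,1,2,\dots\}$, $t_i^*=-\frac{x_{0,1}}{M_0}\tau_i^*=-\frac{x_{0,1}(1-{\alpha^*}^i)}{M_0(1-\alpha^* )}\tau_1^*$ is the junction time of $\lambda_3$. Then $x_1^*(t_i^* )={\alpha^*}^ix_{0,1}$, $x_2^*(t_i^* )=0$, $x_3^*(t_i^* )=M_3$, and $x_4^*(t_i^* )=x_{\infty,4}-{\alpha^*}^{4i}(x_{\infty,4}-x_{0,4})$. The chattering limit time is $t_\infty^*=-\frac{x_{0,1}}{M_0}\tau_\infty^*\in(0,\infty)$, and $x_{\infty,4}=x_4^*(t_\infty^* )=x_{0,4}-\frac{x_{0,1}}{M_0}\Big(\frac{x_{0,1}^3}{M_0^2}\widehat J^*+M_3\tau_\infty^*\Big)$. Specifically, $x^*(t_\infty^* )=(0,0,M_3,x_{\infty,4})$. 2. For every $i\ge1$, the optimal control in $(t_{i-1}^*,t_i^* )$ is, for all $\beta\in(0,1)$, $$u^*((1-\beta)t_{i-1}^*+\beta t_i^* )=\begin{cases}M_0,&\beta\in(0,\beta_1^* ),\\ -M_0,&\beta\in(\beta_1^*,\beta_2^*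 ),\\ M_0,&\beta\in(\beta_2^*,1).\end{cases}$$ Furthermore, for all $t\in(t_\infty^*,t_f^* )$, $x_3^*(t)\equiv M_3$ and $u^*(t)\equiv0$, where $t_f^*=\frac{x_{f4}-x_{0,4}}{M_3}+\frac{x_{0,1}^4\widehat J^*}{M_0^3M_3}\ge t_\infty^*$.
   Context: Problem (Q): given $M_0,M_3\in(0,\infty)$, $x_{0,1}<0$, $x_{0,4},x_{f4}\in\mathbb R$, minimize the free terminal time $t_f$ subject to $\dot x_4=x_3$, $\dot x_3=x_2$, $\dot x_2=x_1$, $\dot x_1=u$, $x(0)=(x_{0,1},0,M_3,x_{0,4})$, $x(t_f)=(0,0,M_3,x_{f4})$, and $x_3(t)\le M_3$, $|u(t)|\le M_0$ for all $t\in[0,t_f]$. The optimal solution is denoted $x^*,u^*,t_f^*$; $\lambda_3$ is the costate of $x_3$ in Pontryagin's principle. A junction time of $\lambda_3$ is a time at which the constraint $x_3\le M_3$ switches between active ($x_3=M_3$) and inactive ($x_3<M_3$); these are the times at which $\lambda_3$ may jump. Chattering means that the control switches infinitely many times in a finite interval, the switching times accumulating at the limit time. Problem (R): minimize $\widehat J=\int_0^\infty y_3(\tau)\,d\tau$ subject to $\dot y_3=y_2$, $\dot y_2=y_1$, $\dot y_1=v$, $y(0)=(1,0,0)$, $y_3(\tau)\ge0$ and $|v(\tau)|\le1$ for all $\tau\in(0,\infty)$. Constants: $(\alpha^*,\tau_1^*,\tau_\infty^*,\beta_1^*,\beta_2^*,\beta_3^* )$ is the unique solution with $0<\beta_1<\beta_2<1<\beta_3$,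 $\alpha\in(0,1)$, $\tau_1>0$ of $(1-2(1-\beta_1)+2(1-\beta_2))\tau_1=1-\alpha$; $(1-2(1-\beta_1)^2+2(1-\beta_2)^2)\tau_1=2$; $(1-2(1-\beta_1)^3+2(1-\beta_2)^3)\tau_1=3$; $2(\beta_1+\beta_2+\beta_3)+(\alpha^2-1)\sum_{1\le j<k\le3}\beta_j\beta_k=3$; $\beta_1+\beta_2+\beta_3-\sum_{1\le j<k\le3}\beta_j\beta_k-\beta_1\beta_2\beta_3(\alpha^3-1)=1$; $\tau_\infty=\tau_1/(1-\alpha)$. Numerically $\alpha^*\approx0.1660687$, $\tau_1^*\approx4.2479105$, $\tau_\infty^*\approx5.0938372$, $\beta_1^*\approx0.4698574$, $\beta_2^*\approx0.8716996$, $\beta_3^*\approx1.0283610$. For $i\ge0$, $\tau_i^*=\frac{1-{\alpha^*}^i}{1-\alpha^*}\tau_1^*$.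
   Formalization: The printed formula for x_4^*(t_i^* ) is false for i≥1 (the drift M_3 t is dropped); proved instead is x_4^*(t_i^* ) = x_{∞,4} − α*^{4i}(x_{∞,4} − x_{0,4}) − (α*^i − α*^{4i}) M_3 t_∞^*. *)

theory Defs
  imports "HOL-Analysis.Analysis"
begin

(* For an interval I with least element 0: x is absolutely continuous on the compact
   subintervals of I and x' = f almost everywhere, in integral form. Controls are
   therefore Lebesgue measurable and only matter up to null sets. *)
definition ac_primitive_on :: "real set \<Rightarrow> (real \<Rightarrow> real) \<Rightarrow> (real \<Rightarrow> real) \<Rightarrow> bool" where
  "ac_primitive_on I x f \<longleftrightarrow>
     (\<forall>t\<in>I. f absolutely_integrable_on {0..t} \<and> x t = x 0 + integral {0..t} f)"

(* The terminal time tf is part of the candidate. *)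
definition Q_feasible ::
  "real \<Rightarrow> real \<Rightarrow> real \<Rightarrow> real \<Rightarrow> real \<Rightarrow> (real \<Rightarrow> real ^ 4) \<Rightarrow> (real \<Rightarrow> real) \<Rightarrow> real \<Rightarrow> bool" where
  "Q_feasible M0 M3 x01 x04 xf4 x u tf \<longleftrightarrow>
     0 \<le> tf \<and>
     ac_primitive_on {0..tf} (\<lambda>t. x t $ 4) (\<lambda>t. x t $ 3) \<and>
     ac_primitive_on {0..tf} (\<lambda>t. x t $ 3) (\<lambda>t. x t $ 2) \<and>
     ac_primitive_on {0..tf} (\<lambda>t. x t $ 2) (\<lambda>t. x t $ 1) \<and>
     ac_primitive_on {0..tf} (\<lambda>t. x t $ 1) u \<and>
     x 0 = vector [x01, 0, M3, x04] \<and>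
     x tf = vector [0, 0, M3, xf4] \<and>
     (\<forall>t\<in>{0..tf}. x t $ 3 \<le> M3 \<and> \<bar>u t\<bar> \<le> M0)"

definition Q_optimal ::
  "real \<Rightarrow> real \<Rightarrow> real \<Rightarrow> real \<Rightarrow> real \<Rightarrow> (real \<Rightarrow> real ^ 4) \<Rightarrow> (real \<Rightarrow> real) \<Rightarrow> real \<Rightarrow> bool" where
  "Q_optimal M0 M3 x01 x04 xf4 x u tf \<longleftrightarrow>
     Q_feasible M0 M3 x01 x04 xf4 x u tf \<and>
     (\<forall>x' u' tf'. Q_feasible M0 M3 x01 x04 xf4 x' u' tf' \<longrightarrow> tf \<le> tf')"

definition R_feasible :: "(real \<Rightarrow> real ^ 3) \<Rightarrow> (real \<Rightarrow> real) \<Rightarrow> bool" where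
  "R_feasible y v \<longleftrightarrow>
     ac_primitive_on {0..} (\<lambda>\<tau>. y \<tau> $ 3) (\<lambda>\<tau>. y \<tau> $ 2) \<and>
     ac_primitive_on {0..} (\<lambda>\<tau>. y \<tau> $ 2) (\<lambda>\<tau>. y \<tau> $ 1) \<and>
     ac_primitive_on {0..} (\<lambda>\<tau>. y \<tau> $ 1) v \<and>
     y 0 = vector [1, 0, 0] \<and>
     (\<forall>\<tau>>0. 0 \<le> y \<tau> $ 3 \<and> \<bar>v \<tau>\<bar> \<le> 1)"

(* Feasible y whose (nonnegative) cost integral diverges have cost +infinity and do not
   affect the infimum. *)
definition R_opt_value :: real where
  "R_opt_value =
     Inf {J. \<exists>y v. R_feasible y v \<and> ((\<lambda>\<tau>. y \<tau> $ 3) has_integral J) {0..}}"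

definition chattering_constants ::
  "real \<Rightarrow> real \<Rightarrow> real \<Rightarrow> real \<Rightarrow> real \<Rightarrow> real \<Rightarrow> bool" where
  "chattering_constants \<alpha> \<tau>1 \<tau>inf \<beta>1 \<beta>2 \<beta>3 \<longleftrightarrow>
     0 < \<beta>1 \<and> \<beta>1 < \<beta>2 \<and> \<beta>2 < 1 \<and> 1 < \<beta>3 \<and> 0 < \<alpha> \<and> \<alpha> < 1 \<and> 0 < \<tau>1 \<and>
     (1 - 2 * (1 - \<beta>1) + 2 * (1 - \<beta>2)) * \<tau>1 = 1 - \<alpha> \<and>
     (1 - 2 * (1 - \<beta>1) ^ 2 + 2 * (1 - \<beta>2) ^ 2) * \<tau>1 = 2 \<and>
     (1 - 2 * (1 - \<beta>1) ^ 3 + 2 * (1 - \<beta>2) ^ 3) * \<tau>1 = 3 \<and>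
     2 * (\<beta>1 + \<beta>2 + \<beta>3) + (\<alpha> ^ 2 - 1) * (\<beta>1 * \<beta>2 + \<beta>1 * \<beta>3 + \<beta>2 * \<beta>3) = 3 \<and>
     \<beta>1 + \<beta>2 + \<beta>3 - (\<beta>1 * \<beta>2 + \<beta>1 * \<beta>3 + \<beta>2 * \<beta>3)
       - \<beta>1 * \<beta>2 * \<beta>3 * (\<alpha> ^ 3 - 1) = 1 \<and>
     \<tau>inf = \<tau>1 / (1 - \<alpha>)"

(* The constraint x3 \<le> M3 switches between active and inactive at t: both occur on [0, tf]
   arbitrarily close to t. The endpoint t = 0 and accumulation points of switches count. *)
definition junction_time :: "real \<Rightarrow> (real \<Rightarrow> real ^ 4) \<Rightarrow> real \<Rightarrow> real \<Rightarrow> bool" where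
  "junction_time M3 x tf t \<longleftrightarrow>
     t \<in> closure {s\<in>{0..tf}. x s $ 3 = M3} \<inter> closure {s\<in>{0..tf}. x s $ 3 < M3}"

(* The control jumps from the value c to the value d; "almost everywhere" because a control
   is only determined up to null sets. *)
definition switching_time :: "(real \<Rightarrow> real) \<Rightarrow> real \<Rightarrow> bool" where
  "switching_time u t \<longleftrightarrow>
     (\<exists>c d \<epsilon>. c \<noteq> d \<and> 0 < \<epsilon> \<and>
        (AE s in lebesgue. t - \<epsilon> < s \<and> s < t \<longrightarrow> u s = c) \<and>
        (AE s in lebesgue. t < s \<and> s < t + \<epsilon> \<longrightarrow> u s = d))"

definition chattering :: "(real \<Rightarrow> real) \<Rightarrow> real \<Rightarrow> bool" where
  "chattering u T \<longleftrightarrow>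
     infinite {s\<in>{0<..<T}. switching_time u s} \<and>
     T islimpt {s\<in>{0<..<T}. switching_time u s}"

end

theory Submission
  imports Defs
begin

text \<open>
  Writing \<open>x\<^sub>3(t) = M\<^sub>3 + x\<^sub>0\<^sub>1 \<sigma>\<^sup>2 z(t / \<sigma>)\<close> with \<open>\<sigma> = - x\<^sub>0\<^sub>1 / M\<^sub>0\<close> turns a trajectory of (Q) into a
  trajectory \<open>z''' = v\<close> of (R) that ends at rest, and \<open>M\<^sub>3 t\<^sub>f\<close> is an increasing affine function of
  its cost.

  Problem (R) is convex, so optimality follows from a dual certificate. On the cell
  \<open>[\<tau>\<^sub>i, \<tau>\<^sub>i + L]\<close> with \<open>L = \<alpha>\<^sup>i \<tau>\<^sub>1\<close> let \<open>p\<close> be the monic cubic with roots \<open>\<tau>\<^sub>i + \<beta>\<^sub>j L\<close>. The last two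
  equations for the constants say that \<open>p\<close> and \<open>p'\<close> are continuous across the \<open>\<tau>\<^sub>i\<close>, while
  \<open>p''\<close> jumps with a favourable sign. Integrating by parts, \<open>6 \<integral> z\<close> is a constant plus positive
  multiples of the values \<open>z(\<tau>\<^sub>i) \<ge> 0\<close> plus \<open>\<integral> (\<bar>p\<bar> - p v) \<ge> 0\<close>. The first three equations say that
  \<open>v = sgn p\<close> takes \<open>(z'', z', z)\<close> from \<open>(\<alpha>\<^sup>i, 0, 0)\<close> at the left end of the cell to \<open>(\<alpha>\<^sup>i\<^sup>+\<^sup>1, 0, 0)\<close> at
  the right end, so this control attains the bound; conversely equality forces \<open>v = sgn p\<close> almost
  everywhere.
\<close>

section \<open>Absolutely continuous primitives\<close>

text \<open>The cubic comes from Pontryagin's principle: off the contact set the costate of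
  \<open>z''\<close> in (R) has constant third derivative, and \<open>p\<close> is this costate up
  to a constant factor. The costate of \<open>z\<close> is a multiple of \<open>p''\<close>; it may
  jump only where \<open>z = 0\<close>, and only in one direction. Passing to the next cell scales
  \<open>p\<close>, \<open>p'\<close>, \<open>p''\<close> at corresponding points by \<alpha>^3,
  \<alpha>^2, \<alpha>. Matching the first two across a node gives the equations with \<alpha>^3 and
  \<alpha>^2, and \<open>p''\<close> is left to jump.

  A competitor need not touch the constraint at the nodes, so every node contributes a boundary
  term. Continuity of \<open>p\<close> and \<open>p'\<close> makes these terms telescope up to the
  multiples of \<open>z\<close>. The last one tends to 0, since it carries positive powers of the
  cell length while the state stays bounded. Beyond the limit time only \<open>z \<ge> 0\<close>
  enters the bound.

  Keeping the gap of one arbitrary cell in the lower bound turns optimality into uniqueness of the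
  control on that cell.\<close>

lemma ac_primitive_on_subset:
  assumes "ac_primitive_on I x f" "J \<subseteq> I"
  shows "ac_primitive_on J x f"
  using assms unfolding ac_primitive_on_def by blast

lemma ac_primitive_onD:
  assumes "ac_primitive_on I x f" "t \<in> I"
  shows "x 0 + integral {0..t} f = x t" "f absolutely_integrable_on {0..t}" "f integrable_on {0..t}"
proof -
  from assms have *: "f absolutely_integrable_on {0..t} \<and> x t = x 0 + integral {0..t} f"
    unfolding ac_primitive_on_def by blast
  then show "x 0 + integral {0..t} f = x t" "f absolutely_integrable_on {0..t}"
    by (simp_all only:)
  then show "f integrable_on {0..t}"
    by (intro set_lebesgue_integral_eq_integral(1))
qed

lemma ac_primitive_has_integral:
  assumes ac: "ac_primitive_on {0..T} x f" and "0 \<le> a" "a \<le> b" "b \<le> T"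
  shows "(f has_integral (x b - x a)) {a..b}"
proof -
  have fb: "f integrable_on {0..b}" "x b = x 0 + integral {0..b} f" "x a = x 0 + integral {0..a} f"
    using assms(2-4) ac_primitive_onD[OF ac, of a] ac_primitive_onD[OF ac, of b] by simp_all
  have "integral {0..a} f + integral {a..b} f = integral {0..b} f"
    by (rule Henstock_Kurzweil_Integration.integral_combine[OF assms(2,3) fb(1)])
  moreover have "f integrable_on {a..b}"
    by (rule integrable_subinterval_real[OF fb(1)]) (use assms(2) in simp)
  ultimately show ?thesis
    using fb by (simp add: has_integral_iff)
qed

lemma ac_primitive_absolutely_integrable:
  assumes "ac_primitive_on {0..T} x f" "0 \<le> a" "b \<le> T"
  shows "f absolutely_integrable_on {a..b}"
proof (cases "0 \<le> T")
  case True
  then have "f absolutely_integrable_on {0..T}"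
    using ac_primitive_onD(2)[OF assms(1)] by simp
  then show ?thesis
    by (rule absolutely_integrable_on_subinterval) (use assms in auto)
qed (use assms in auto)

lemma ac_primitive_continuous:
  assumes ac: "ac_primitive_on {0..T} x f"
  shows "continuous_on {0..T} x"
proof (cases "0 \<le> T")
  case True
  have "continuous_on {0..T} (\<lambda>t. x 0 + integral {0..t} f)"
    using True ac_primitive_onD(3)[OF ac] by (intro continuous_intros indefinite_integral_continuous_1) simp
  then show ?thesis
    by (rule continuous_on_eq) (use ac_primitive_onD(1)[OF ac] in simp)
qed simp

lemma ac_primitive_onI:
  assumes f: "continuous_on {0..T} f" and x: "\<And>t. t \<in> {0..T} \<Longrightarrow> x t = x 0 + integral {0..t} f"
  shows "ac_primitive_on {0..T} x f"
  unfolding ac_primitive_on_def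
proof (intro ballI conjI)
  fix t assume "t \<in> {0..T}"
  then show "f absolutely_integrable_on {0..t}"
    by (intro absolutely_integrable_continuous_real continuous_on_subset[OF f]) auto
  show "x t = x 0 + integral {0..t} f"
    by (rule x) fact
qed

lemma ac_primitive_has_derivative:
  assumes ac: "ac_primitive_on {0..T} x f" and f: "continuous_on {0..T} f" and t: "t \<in> {0..T}"
  shows "(x has_real_derivative f t) (at t within {0..T})"
proof -
  have "((\<lambda>s. x 0 + integral {0..s} f) has_real_derivative 0 + f t) (at t within {0..T})"
    using integral_has_real_derivative[OF f t] by (intro derivative_intros)
  then have "((\<lambda>s. x 0 + integral {0..s} f) has_real_derivative f t) (at t within {0..T})"
    by simp
  then show ?thesis
    by (rule has_field_derivative_transform_within[OF _ zero_less_one t])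
      (use ac_primitive_onD(1)[OF ac] in simp)
qed

text \<open>The difference quotients are bounded by a multiple of \<open>\<bar>t - s\<bar>\<close>,
  so the derivative is 0 everywhere.\<close>

lemma quadratic_increment_imp_const:
  fixes f :: "real \<Rightarrow> real"
  assumes "a \<le> b" and le: "\<And>s t. a \<le> s \<Longrightarrow> s \<le> t \<Longrightarrow> t \<le> b \<Longrightarrow> \<bar>f t - f s\<bar> \<le> C * (t - s)^2"
  shows "f b = f a"
proof -
  \<comment> \<open>\<open>C\<close> carries no sign assumption, and the derivative needs pairs in
    either order. Passing to \<open>\<bar>C\<bar>\<close> settles both.\<close>
  have le': "\<bar>f t - f s\<bar> \<le> \<bar>C\<bar> * (t - s)^2" if "s \<in> {a..b}" "t \<in> {a..b}" for s t
  proof -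
    have *: "C * (t - s)^2 \<le> \<bar>C\<bar> * (t - s)^2"
      by (simp add: mult_right_mono)
    show ?thesis
    proof (cases "s \<le> t")
      case True
      then show ?thesis using le[of s t] that * by simp
    next
      case False
      then have "\<bar>f s - f t\<bar> \<le> C * (s - t)^2" using le[of t s] that by simp
      then show ?thesis using * by (simp add: abs_minus_commute power2_commute)
    qed
  qed
  have "(f has_real_derivative 0) (at s within {a..b})" if s: "s \<in> {a..b}" for s
    unfolding has_field_derivative_iff
  proof (rule Lim_null_comparison)
    have "\<bar>(f t - f s) / (t - s)\<bar> \<le> \<bar>C\<bar> * \<bar>t - s\<bar>" if "t \<in> {a..b}" "t \<noteq> s" for t
    proof -
      have "\<bar>f t - f s\<bar> \<le> (\<bar>C\<bar> * \<bar>t - s\<bar>) * \<bar>t - s\<bar>"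
        using le'[OF s that(1)] by (simp add: power2_eq_square mult.assoc)
      then show ?thesis
        using that by (simp add: abs_divide divide_le_eq)
    qed
    then show "\<forall>\<^sub>F t in at s within {a..b}. norm ((f t - f s) / (t - s)) \<le> \<bar>C\<bar> * \<bar>t - s\<bar>"
      by (auto simp: eventually_at_filter)
    have "((\<lambda>t. \<bar>C\<bar> * \<bar>t - s\<bar>) \<longlongrightarrow> \<bar>C\<bar> * \<bar>s - s\<bar>) (at s within {a..b})"
      by (intro tendsto_intros)
    then show "((\<lambda>t. \<bar>C\<bar> * \<bar>t - s\<bar>) \<longlongrightarrow> 0) (at s within {a..b})"
      by simp
  qed
  then have "\<exists>c. \<forall>x\<in>{a..b}. f x = c"
    by (intro has_field_derivative_zero_constant) auto
  then show ?thesis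
    using \<open>a \<le> b\<close> by auto
qed

text \<open>Here \<open>V\<close> need not be differentiable. The defect of the formula on \<open>{s..t}\<close> is of second order
  in \<open>t - s\<close>, hence it vanishes.\<close>

lemma has_integral_by_parts_bounded:
  fixes v V p p' :: "real \<Rightarrow> real"
  assumes ab: "a \<le> b"
    and v: "v absolutely_integrable_on {a..b}" and C: "\<And>t. t \<in> {a..b} \<Longrightarrow> \<bar>v t\<bar> \<le> C"
    and V: "\<And>s t. a \<le> s \<Longrightarrow> s \<le> t \<Longrightarrow> t \<le> b \<Longrightarrow> (v has_integral (V t - V s)) {s..t}"
    and p: "\<And>t. (p has_real_derivative p' t) (at t)" and p': "continuous_on UNIV p'"
  shows "((\<lambda>t. p t * v t) has_integral (p b * V b - p a * V a - integral {a..b} (\<lambda>t. p' t * V t))) {a..b}"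
proof -
  have "a \<in> {a..b}" using ab by simp
  then have C0: "0 \<le> C" using C[of a] by linarith
  have contp: "continuous_on S p" for S
    using p by (meson DERIV_isCont continuous_at_imp_continuous_on)
  have contp': "continuous_on S p'" for S
    using p' continuous_on_subset by blast
  have pint: "(p' has_integral (p t - p s)) {s..t}" if "s \<le> t" for s t
    using that p by (intro fundamental_theorem_of_calculus)
      (auto simp: has_real_derivative_iff_has_vector_derivative[symmetric] intro: DERIV_subset)
  have VL: "\<bar>V t - V s\<bar> \<le> C * (t - s)" if "a \<le> s" "s \<le> t" "t \<le> b" for s t
    using has_integral_bound_real[OF C0 finite.emptyI V[OF that]] that C by auto
  have contV: "continuous_on {a..b} V"
  proof -
    have "continuous_on {a..b} (\<lambda>t. V a + integral {a..t} v)"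
      by (intro continuous_intros indefinite_integral_continuous_1 set_lebesgue_integral_eq_integral(1) v)
    then show ?thesis
      by (rule continuous_on_eq) (simp add: integral_unique[OF V])
  qed
  have "compact (p' ` {a..b})"
    by (intro compact_continuous_image contp') auto
  then have "bounded (p' ` {a..b})"
    by (rule compact_imp_bounded)
  then obtain P where P: "\<And>t. t \<in> {a..b} \<Longrightarrow> \<bar>p' t\<bar> \<le> P"
    unfolding bounded_iff by (metis image_eqI real_norm_def)
  have P0: "0 \<le> P" using P[OF \<open>a \<in> {a..b}\<close>] by linarith
  have pL: "\<bar>p t - p s\<bar> \<le> P * (t - s)" if "a \<le> s" "s \<le> t" "t \<le> b" for s t
    using has_integral_bound_real[OF P0 finite.emptyI pint[OF that(2)]] that P by auto
  have pvi: "(\<lambda>t. p t * v t) absolutely_integrable_on {a..b}"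
  proof (rule absolutely_integrable_bounded_measurable_product_real[OF _ _ _ v])
    show "p \<in> borel_measurable (lebesgue_on {a..b})"
      by (rule continuous_imp_measurable_on_sets_lebesgue[OF contp]) simp
    show "bounded (p ` {a..b})"
      by (rule compact_imp_bounded[OF compact_continuous_image[OF contp]]) simp
  qed simp
  then have pvi': "(\<lambda>t. p t * v t) integrable_on {a..b}"
    using set_lebesgue_integral_eq_integral(1) by blast
  have p'Vi: "(\<lambda>t. p' t * V t) integrable_on {a..b}"
    by (intro integrable_continuous_real continuous_intros contp' contV)
  define \<Phi> where "\<Phi> t = integral {a..t} (\<lambda>t. p t * v t) - p t * V t + integral {a..t} (\<lambda>t. p' t * V t)" for t
  have "\<bar>\<Phi> t - \<Phi> s\<bar> \<le> (2 * P * C) * (t - s)^2" if st: "a \<le> s" "s \<le> t" "t \<le> b" for s t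
  proof -
    have sub: "(\<lambda>t. p t * v t) integrable_on {s..t}" "(\<lambda>t. p' t * V t) integrable_on {s..t}"
      "(\<lambda>t. p t * v t) integrable_on {a..t}" "(\<lambda>t. p' t * V t) integrable_on {a..t}"
      by (rule integrable_subinterval_real[OF pvi'] integrable_subinterval_real[OF p'Vi]; use st in simp)+
    have c1: "integral {a..s} (\<lambda>t. p t * v t) + integral {s..t} (\<lambda>t. p t * v t) = integral {a..t} (\<lambda>t. p t * v t)"
      by (rule Henstock_Kurzweil_Integration.integral_combine[OF st(1,2) sub(3)])
    have c2: "integral {a..s} (\<lambda>t. p' t * V t) + integral {s..t} (\<lambda>t. p' t * V t) = integral {a..t} (\<lambda>t. p' t * V t)"
      by (rule Henstock_Kurzweil_Integration.integral_combine[OF st(1,2) sub(4)])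
    have h: "((\<lambda>r. (p r * v r - p s * v r) + (p' r * V r - p' r * V t)) has_integral
       ((integral {s..t} (\<lambda>t. p t * v t) - p s * (V t - V s)) + (integral {s..t} (\<lambda>t. p' t * V t) - (p t - p s) * V t))) {s..t}"
      by (intro has_integral_add has_integral_diff has_integral_mult_right has_integral_mult_left
          V pint st integrable_integral sub)
    have eq: "\<Phi> t - \<Phi> s = (integral {s..t} (\<lambda>t. p t * v t) - p s * (V t - V s)) + (integral {s..t} (\<lambda>t. p' t * V t) - (p t - p s) * V t)"
      unfolding \<Phi>_def using c1 c2 by (simp add: algebra_simps)
    have "\<bar>\<Phi> t - \<Phi> s\<bar> \<le> (2 * P * C * (t - s)) * (t - s)"
    proof -
      have bd: "\<bar>(p r * v r - p s * v r) + (p' r * V r - p' r * V t)\<bar> \<le> 2 * P * C * (t - s)" if r: "r \<in> {s..t}" for r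
      proof -
        have "P * (r - s) \<le> P * (t - s)" "C * (t - r) \<le> C * (t - s)"
          using r P0 C0 by (auto intro!: mult_left_mono)
        then have "\<bar>p r - p s\<bar> \<le> P * (t - s)" "\<bar>V t - V r\<bar> \<le> C * (t - s)"
          using pL[of s r] VL[of r t] r st by auto
        moreover have "\<bar>v r\<bar> \<le> C" "\<bar>p' r\<bar> \<le> P"
          using C[of r] P[of r] r st by auto
        ultimately have "\<bar>p r - p s\<bar> * \<bar>v r\<bar> \<le> (P * (t - s)) * C"
            "\<bar>p' r\<bar> * \<bar>V t - V r\<bar> \<le> P * (C * (t - s))"
          using P0 C0 st by (auto intro!: mult_mono)
        then have "\<bar>(p r - p s) * v r\<bar> + \<bar>p' r * (V t - V r)\<bar> \<le> 2 * P * C * (t - s)"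
          unfolding abs_mult by (simp add: algebra_simps)
        moreover have "(p r * v r - p s * v r) + (p' r * V r - p' r * V t) = (p r - p s) * v r - p' r * (V t - V r)"
          by (simp add: algebra_simps)
        ultimately show ?thesis by linarith
      qed
      have "0 \<le> 2 * P * C * (t - s)"
        using P0 C0 st by simp
      from has_integral_bound_real[OF this finite.emptyI h] bd
      have "norm (\<Phi> t - \<Phi> s) \<le> 2 * P * C * (t - s) * Henstock_Kurzweil_Integration.content {s..t}"
        unfolding eq real_norm_def by blast
      then show ?thesis
        using st by simp
    qed
    then show ?thesis by (simp add: power2_eq_square mult.assoc)
  qed
  then have "\<Phi> b = \<Phi> a"
    by (rule quadratic_increment_imp_const[OF ab])
  then have "integral {a..b} (\<lambda>t. p t * v t) = p b * V b - p a * V a - integral {a..b} (\<lambda>t. p' t * V t)"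
    unfolding \<Phi>_def by simp
  then show ?thesis
    using pvi' by (metis integrable_integral)
qed

section \<open>The triple integrator\<close>

definition triple_integrator ::
  "real set \<Rightarrow> (real \<Rightarrow> real) \<Rightarrow> (real \<Rightarrow> real) \<Rightarrow> (real \<Rightarrow> real) \<Rightarrow> (real \<Rightarrow> real) \<Rightarrow> bool" where
  "triple_integrator I z z1 z2 v \<longleftrightarrow>
     ac_primitive_on I z z1 \<and> ac_primitive_on I z1 z2 \<and> ac_primitive_on I z2 v"

lemma triple_integrator_subset:
  assumes "triple_integrator I z z1 z2 v" "J \<subseteq> I"
  shows "triple_integrator J z z1 z2 v"
  using assms ac_primitive_on_subset unfolding triple_integrator_def by blast

lemma triple_integrator_continuous:
  assumes "triple_integrator {0..T} z z1 z2 v"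
  shows "continuous_on {0..T} z" "continuous_on {0..T} z1" "continuous_on {0..T} z2"
  using assms ac_primitive_continuous unfolding triple_integrator_def by blast+

lemma has_integral_cong_AE_interval:
  fixes f g :: "real \<Rightarrow> real"
  assumes "AE t in lebesgue. a < t \<and> t < b \<longrightarrow> g t = f t" "(f has_integral y) {a..b}"
  shows "(g has_integral y) {a..b}"
proof -
  obtain N where N: "negligible N" "{t. \<not> (a < t \<and> t < b \<longrightarrow> g t = f t)} \<subseteq> N"
    using assms(1) unfolding eventually_ae_filter_negligible by blast
  show ?thesis
  proof (rule has_integral_spike[OF _ _ assms(2)])
    show "negligible (insert a (insert b N))"
      using N(1) by simp
    show "g t = f t" if "t \<in> {a..b} - insert a (insert b N)" for t
      using that N(2) by force
  qed
qed

lemma integral_nonneg_0_imp_AE: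
  fixes f :: "real \<Rightarrow> real"
  assumes f: "f absolutely_integrable_on S" and nn: "\<And>t. t \<in> S \<Longrightarrow> 0 \<le> f t" and 0: "integral S f = 0"
  shows "AE t in lebesgue. t \<in> S \<longrightarrow> f t = 0"
proof -
  have "integral\<^sup>L lebesgue (\<lambda>t. indicator S t *\<^sub>R f t) = 0"
    using set_lebesgue_integral_eq_integral(2)[OF f] 0 by (simp add: set_lebesgue_integral_def)
  moreover have "integrable lebesgue (\<lambda>t. indicator S t *\<^sub>R f t)"
    using f by (simp add: set_integrable_def)
  ultimately have "AE t in lebesgue. indicator S t *\<^sub>R f t = 0"
    using nn by (subst (asm) integral_nonneg_eq_0_iff_AE) (auto simp: indicator_def)
  then show ?thesis
    by eventually_elim (auto simp: indicator_def split: if_splits)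
qed

lemma triple_integrator_const:
  assumes ti: "triple_integrator {0..T} z z1 z2 v"
    and a: "0 \<le> a" "b \<le> T" and v: "AE t in lebesgue. a < t \<and> t < b \<longrightarrow> v t = c"
    and t: "a \<le> t" "t \<le> b"
  shows "z2 t = z2 a + c * (t - a)"
    "z1 t = z1 a + z2 a * (t - a) + c * (t - a)^2 / 2"
    "z t = z a + z1 a * (t - a) + z2 a * (t - a)^2 / 2 + c * (t - a)^3 / 6"
proof -
  have ac: "ac_primitive_on {0..T} z z1" "ac_primitive_on {0..T} z1 z2" "ac_primitive_on {0..T} z2 v"
    using ti by (auto simp: triple_integrator_def)
  have 2: "z2 t = z2 a + c * (t - a)" if t: "a \<le> t" "t \<le> b" for t
  proof -
    have "((\<lambda>_. c) has_integral c * (t - a)) {a..t}"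
      using has_integral_const_real[of c a t] t by (simp add: mult.commute)
    moreover have "AE s in lebesgue. a < s \<and> s < t \<longrightarrow> v s = c"
      using v by eventually_elim (use t in auto)
    ultimately have "(v has_integral c * (t - a)) {a..t}"
      by (rule has_integral_cong_AE_interval[rotated])
    moreover have "(v has_integral (z2 t - z2 a)) {a..t}"
      by (rule ac_primitive_has_integral[OF ac(3)]) (use t a in auto)
    ultimately show ?thesis
      by (auto dest: has_integral_unique)
  qed
  have 1: "z1 t = z1 a + z2 a * (t - a) + c * (t - a)^2 / 2" if t: "a \<le> t" "t \<le> b" for t
  proof -
    have "((\<lambda>s. z2 a + c * (s - a)) has_integral
       ((z2 a * (t - a) + c * (t - a)^2 / 2) - (z2 a * (a - a) + c * (a - a)^2 / 2))) {a..t}"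
      using t(1) by (intro fundamental_theorem_of_calculus)
       (auto simp: has_real_derivative_iff_has_vector_derivative[symmetric] intro!: derivative_eq_intros)
    then have "((\<lambda>s. z2 a + c * (s - a)) has_integral (z2 a * (t - a) + c * (t - a)^2 / 2)) {a..t}"
      by simp
    then have "(z2 has_integral (z2 a * (t - a) + c * (t - a)^2 / 2)) {a..t}"
      by (rule has_integral_eq[rotated]) (rule 2[symmetric]; use t in simp)
    moreover have "(z2 has_integral (z1 t - z1 a)) {a..t}"
      by (rule ac_primitive_has_integral[OF ac(2)]) (use t a in auto)
    ultimately show ?thesis
      by (auto dest: has_integral_unique)
  qed
  have "((\<lambda>s. z1 a + z2 a * (s - a) + c * (s - a)^2 / 2) has_integral
     ((z1 a * (t - a) + z2 a * (t - a)^2 / 2 + c * (t - a)^3 / 6)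
      - (z1 a * (a - a) + z2 a * (a - a)^2 / 2 + c * (a - a)^3 / 6))) {a..t}"
    using t(1) by (intro fundamental_theorem_of_calculus)
     (auto simp: has_real_derivative_iff_has_vector_derivative[symmetric] field_simps intro!: derivative_eq_intros)
  then have "((\<lambda>s. z1 a + z2 a * (s - a) + c * (s - a)^2 / 2) has_integral
     (z1 a * (t - a) + z2 a * (t - a)^2 / 2 + c * (t - a)^3 / 6)) {a..t}"
    by simp
  then have "(z1 has_integral (z1 a * (t - a) + z2 a * (t - a)^2 / 2 + c * (t - a)^3 / 6)) {a..t}"
    by (rule has_integral_eq[rotated]) (rule 1[symmetric]; use t in simp)
  moreover have "(z1 has_integral (z t - z a)) {a..t}"
    by (rule ac_primitive_has_integral[OF ac(1)]) (use t a in auto)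
  ultimately show "z t = z a + z1 a * (t - a) + z2 a * (t - a)^2 / 2 + c * (t - a)^3 / 6"
    by (auto dest: has_integral_unique)
  show "z2 t = z2 a + c * (t - a)" "z1 t = z1 a + z2 a * (t - a) + c * (t - a)^2 / 2"
    by (rule 2[OF t] 1[OF t])+
qed

text \<open>Three integrations by parts move the derivatives from \<open>v\<close> onto the monic
  cubic, whose third derivative is 6. The bounds required for \<open>z1\<close> and
  \<open>z2\<close> come from continuity on a compact interval; the one for \<open>v\<close> is the
  control constraint.\<close>

lemma triple_integrator_cubic_duality:
  fixes r1 r2 r3 :: real
  defines "p \<equiv> \<lambda>t. (t - r1) * (t - r2) * (t - r3)"
    and "p' \<equiv> \<lambda>t. (t - r1) * (t - r2) + (t - r1) * (t - r3) + (t - r2) * (t - r3)"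
    and "p'' \<equiv> \<lambda>t. 6 * t - 2 * (r1 + r2 + r3)"
  assumes ti: "triple_integrator {0..T} z z1 z2 v" and ab: "0 \<le> a" "a \<le> b" "b \<le> T"
    and v: "\<And>t. t \<in> {0..T} \<Longrightarrow> \<bar>v t\<bar> \<le> C"
  shows "((\<lambda>t. p t * v t) has_integral
     (p b * z2 b - p' b * z1 b + p'' b * z b) - (p a * z2 a - p' a * z1 a + p'' a * z a)
       - 6 * integral {a..b} z) {a..b}"
proof -
  have ac: "ac_primitive_on {0..T} z z1" "ac_primitive_on {0..T} z1 z2" "ac_primitive_on {0..T} z2 v"
    using ti by (auto simp: triple_integrator_def)
  have sub: "{a..b} \<subseteq> {0..T}" using ab by auto
  have cont: "continuous_on {a..b} z" "continuous_on {a..b} z1" "continuous_on {a..b} z2"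
    using triple_integrator_continuous[OF ti] continuous_on_subset sub by blast+
  have bd: "\<exists>B. \<forall>t\<in>{a..b}. \<bar>f t\<bar> \<le> B" if "continuous_on {a..b} f" for f :: "real \<Rightarrow> real"
    using compact_imp_bounded[OF compact_continuous_image[OF that]] by (auto simp: bounded_iff)
  obtain B1 B2 where B1: "\<And>t. t\<in>{a..b} \<Longrightarrow> \<bar>z1 t\<bar> \<le> B1" and B2: "\<And>t. t\<in>{a..b} \<Longrightarrow> \<bar>z2 t\<bar> \<le> B2"
    using bd[OF cont(2)] bd[OF cont(3)] by blast
  have I: "(f has_integral x t - x s) {s..t}" if "ac_primitive_on {0..T} x f" "a \<le> s" "s \<le> t" "t \<le> b" for x f s t
    by (rule ac_primitive_has_integral[OF that(1)]) (use that ab in auto)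
  have d: "(p has_real_derivative p' t) (at t)" "(p' has_real_derivative p'' t) (at t)"
    "(p'' has_real_derivative 6) (at t)" for t
    unfolding p_def p'_def p''_def by (rule derivative_eq_intros refl | simp add: algebra_simps)+
  have c: "continuous_on UNIV p'" "continuous_on UNIV p''" "continuous_on UNIV (\<lambda>_::real. 6::real)"
    unfolding p'_def p''_def by (intro continuous_intros)+
  have i0: "((\<lambda>t. p t * v t) has_integral (p b * z2 b - p a * z2 a - integral {a..b} (\<lambda>t. p' t * z2 t))) {a..b}"
    by (rule has_integral_by_parts_bounded[OF ab(2) ac_primitive_absolutely_integrable[OF ac(3) ab(1,3)]
        v[OF subsetD[OF sub]] I[OF ac(3)] d(1) c(1)])
  have i1: "((\<lambda>t. p' t * z2 t) has_integral (p' b * z1 b - p' a * z1 a - integral {a..b} (\<lambda>t. p'' t * z1 t))) {a..b}"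
    by (rule has_integral_by_parts_bounded[OF ab(2) ac_primitive_absolutely_integrable[OF ac(2) ab(1,3)]
        B2 I[OF ac(2)] d(2) c(2)])
  have i2: "((\<lambda>t. p'' t * z1 t) has_integral (p'' b * z b - p'' a * z a - integral {a..b} (\<lambda>t. 6 * z t))) {a..b}"
    by (rule has_integral_by_parts_bounded[OF ab(2) ac_primitive_absolutely_integrable[OF ac(1) ab(1,3)]
        B1 I[OF ac(1)] d(3) c(3)])
  show ?thesis
    by (rule has_integral_eq_rhs[OF i0]) (use integral_unique[OF i1] integral_unique[OF i2] in simp)
qed

text \<open>A uniqueness-of-measure argument: vanishing integrals over intervals extend to all Borel
  sets by induction, and a density whose integral over every Borel set is 0 vanishes almost
  everywhere.\<close>

lemma subinterval_integrals_0_imp_AE_0: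
  fixes f :: "real \<Rightarrow> real"
  assumes f: "f absolutely_integrable_on {a..b}"
    and 0: "\<And>s t. a \<le> s \<Longrightarrow> s \<le> t \<Longrightarrow> t \<le> b \<Longrightarrow> (f has_integral 0) {s..t}"
  shows "AE t in lebesgue. t \<in> {a..b} \<longrightarrow> f t = 0"
proof -
  define g where "g t = indicator {a..b} t * f t" for t
  have g: "integrable lebesgue g"
    using f by (simp add: set_integrable_def g_def[abs_def])
  \<comment> \<open>\<open>f\<close> is only Lebesgue measurable, while the induction runs over
    Borel sets. A Borel representative of the extension of \<open>f\<close> by 0 takes its
    place.\<close>
  then obtain g' where g': "g' \<in> borel_measurable lborel" "AE t in lborel. g t = g' t"
    using completion_ex_borel_measurable_real[of g lborel] by auto
  have ae: "AE t in lebesgue. g t = g' t"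
    using g'(2) by (rule AE_completion)
  have "integrable lebesgue g'"
    by (rule integrable_cong_AE_imp[OF g measurable_completion[OF g'(1)]]) (use ae in \<open>auto simp: eq_commute\<close>)
  then have ig': "integrable lborel g'"
    using g'(1) by (simp add: integrable_completion)
  have si: "set_integrable lborel A g'" if "A \<in> sets borel" for A
    using that integrable_mult_indicator[OF _ ig', of A] by (simp add: set_integrable_def)
  have eq: "(LINT t:A|lborel. g' t) = (LINT t:(A \<inter> {a..b})|lebesgue. f t)" if A: "A \<in> sets borel" for A
  proof -
    have "(LINT t:A|lborel. g' t) = (LINT t|lebesgue. indicator A t *\<^sub>R g' t)"
      unfolding set_lebesgue_integral_def using A g'(1) by (subst integral_completion) auto
    also have "\<dots> = (LINT t|lebesgue. indicator (A \<inter> {a..b}) t *\<^sub>R f t)"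
    proof (rule integral_cong_AE)
      show "(\<lambda>t. indicator A t *\<^sub>R g' t) \<in> borel_measurable lebesgue"
        using A g'(1) by (intro measurable_completion) auto
      have "(\<lambda>t. indicator A t *\<^sub>R g t) \<in> borel_measurable lebesgue"
        using A borel_measurable_integrable[OF g] by (intro borel_measurable_scaleR borel_measurable_indicator) auto
      then show "(\<lambda>t. indicator (A \<inter> {a..b}) t *\<^sub>R f t) \<in> borel_measurable lebesgue"
        by (simp add: g_def indicator_inter_arith mult.assoc)
      show "AE t in lebesgue. indicator A t *\<^sub>R g' t = indicator (A \<inter> {a..b}) t *\<^sub>R f t"
        using ae by eventually_elim (auto simp: g_def indicator_def)
    qed
    finally show ?thesis by (simp add: set_lebesgue_integral_def)
  qed
  have box: "(LINT t:{s..u}|lborel. g' t) = 0" for s u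
  proof (cases "max s a \<le> min u b")
    case True
    have int: "{s..u} \<inter> {a..b} = {max s a..min u b}" by auto
    have "f absolutely_integrable_on {max s a..min u b}"
      by (rule absolutely_integrable_on_subinterval[OF f]) auto
    then have "(LINT t:{max s a..min u b}|lebesgue. f t) = integral {max s a..min u b} f"
      by (rule set_lebesgue_integral_eq_integral(2))
    also have "\<dots> = 0"
      by (rule integral_unique[OF 0]) (use True in auto)
    finally show ?thesis
      using eq[of "{s..u}"] int by simp
  next
    case False
    then have "{s..u} \<inter> {a..b} = {}" by auto
    then show ?thesis using eq[of "{s..u}"] by (simp add: set_lebesgue_integral_def)
  qed
  have "(LINT t:A|lborel. g' t) = 0" if "A \<in> sets borel" for A
    using that
  proof (induction rule: borel_set_induct)
    case (compl A)
    \<comment> \<open>Complements require the total integral to be 0. It equals the integral over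
      \<open>{a..b}\<close>, outside of which \<open>g'\<close> vanishes almost everywhere.\<close>
    have "(LINT t:UNIV|lborel. g' t) = (LINT t:{a..b}|lborel. g' t)"
      using eq[of UNIV] eq[of "{a..b}"] by simp
    then have "(LINT t:A \<union> - A|lborel. g' t) = 0"
      using box by simp
    then show ?case
      using set_integral_Un[of A "- A" lborel g'] si[OF compl(1)] si[OF borel_comp[OF compl(1)]] compl by simp
  next
    case (union A)
    have "(LINT t:(\<Union>i. A i)|lborel. g' t) = (\<Sum>i. (LINT t:A i|lborel. g' t))"
      by (rule lebesgue_integral_countable_add) (use union si in \<open>auto simp: disjoint_family_on_def\<close>)
    then show ?case using union by simp
  next
    case (interval s u)
    show ?case by (rule box)
  qed (simp add: set_lebesgue_integral_def)
  then have "AE t in lborel. g' t = 0"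
    using density_unique_real[OF ig', of "\<lambda>_. 0"] by (simp add: set_lebesgue_integral_def)
  then have "AE t in lebesgue. g' t = 0"
    by (rule AE_completion)
  with ae show ?thesis
    by eventually_elim (auto simp: g_def)
qed

section \<open>Shifting, rescaling, extending and differentiating primitives\<close>

lemma ac_primitive_on_atLeast:
  assumes "\<And>T. 0 \<le> T \<Longrightarrow> ac_primitive_on {0..T} x f"
  shows "ac_primitive_on {0..} x f"
  unfolding ac_primitive_on_def
proof
  fix t :: real assume "t \<in> {0..}"
  then have "ac_primitive_on {0..t} x f" "t \<in> {0..t}" using assms by auto
  then show "f absolutely_integrable_on {0..t} \<and> x t = x 0 + integral {0..t} f"
    unfolding ac_primitive_on_def by blast
qed

lemma ac_primitive_on_add_const:
  assumes "ac_primitive_on I x f"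
  shows "ac_primitive_on I (\<lambda>t. d + x t) f"
  unfolding ac_primitive_on_def
proof (intro ballI conjI)
  fix t assume t: "t \<in> I"
  show "f absolutely_integrable_on {0..t}"
    by (rule ac_primitive_onD(2)[OF assms t])
  show "d + x t = d + x 0 + integral {0..t} f"
    using ac_primitive_onD(1)[OF assms t] by simp
qed

lemma ac_primitive_on_rescale:
  assumes ac: "ac_primitive_on {0..T} x f" and \<sigma>: "0 < \<sigma>"
  shows "ac_primitive_on {0..T / \<sigma>} (\<lambda>t. c * x (\<sigma> * t)) (\<lambda>t. c * \<sigma> * f (\<sigma> * t))"
  unfolding ac_primitive_on_def
proof (intro ballI conjI)
  fix t assume t: "t \<in> {0..T / \<sigma>}"
  then have t': "\<sigma> * t \<in> {0..T}" using \<sigma> by (auto simp: field_simps)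
  have resc: "((\<lambda>s. h (\<sigma> * s)) has_integral (integral {0..\<sigma> * t} h / \<sigma>)) {0..t}"
    if "h integrable_on {0..\<sigma> * t}" for h :: "real \<Rightarrow> real"
  proof -
    have h: "(h has_integral integral {0..\<sigma> * t} h) (cbox 0 (\<sigma> * t))"
      using that by (simp add: integrable_integral)
    show ?thesis
      using has_integral_affinity'[OF h \<sigma>, of 0] \<sigma> by (simp add: field_simps)
  qed
  note f = ac_primitive_onD(3)[OF ac t']
  have nf: "(\<lambda>s. norm (f s)) integrable_on {0..\<sigma> * t}"
    using ac_primitive_onD(2)[OF ac t'] by (simp add: absolutely_integrable_on_def)
  have I: "((\<lambda>s. c * \<sigma> * f (\<sigma> * s)) has_integral (c * \<sigma> * (integral {0..\<sigma> * t} f / \<sigma>))) {0..t}"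
    by (rule has_integral_mult_right[OF resc[OF f]])
  have "((\<lambda>s. \<bar>c * \<sigma>\<bar> * norm (f (\<sigma> * s))) has_integral (\<bar>c * \<sigma>\<bar> * (integral {0..\<sigma> * t} (\<lambda>s. norm (f s)) / \<sigma>))) {0..t}"
    by (rule has_integral_mult_right[OF resc[OF nf]])
  then have N: "(\<lambda>s. norm (c * \<sigma> * f (\<sigma> * s))) integrable_on {0..t}"
    by (auto simp: abs_mult integrable_on_def)
  show "(\<lambda>s. c * \<sigma> * f (\<sigma> * s)) absolutely_integrable_on {0..t}"
    using I N by (auto simp: absolutely_integrable_on_def)
  show "c * x (\<sigma> * t) = c * x (\<sigma> * 0) + integral {0..t} (\<lambda>s. c * \<sigma> * f (\<sigma> * s))"
    unfolding integral_unique[OF I] ac_primitive_onD(1)[OF ac t', symmetric] using \<sigma>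
    by (simp add: distrib_left)
qed

text \<open>\<open>x T = 0\<close> makes the extension continuous at \<open>T\<close>, hence still a
  primitive although \<open>f\<close> is cut off abruptly. This prolongs a trajectory that has come
  to rest, so that trajectories of different durations can be compared on one interval.\<close>

lemma ac_primitive_on_extend_zero:
  assumes ac: "ac_primitive_on {0..T} x f" and T: "0 \<le> T" and "x T = 0"
  shows "ac_primitive_on {0..} (\<lambda>t. if t \<in> {0..T} then x t else 0) (\<lambda>t. if t \<in> {0..T} then f t else 0)"
  unfolding ac_primitive_on_def
proof (intro ballI conjI)
  fix t :: real assume t: "t \<in> {0..}"
  define m where "m = min t T"
  have m: "m \<in> {0..T}" "{0..m} \<subseteq> {0..t}" using t T by (auto simp: m_def)
  \<comment> \<open>\<open>h\<close> will be the identity and \<open>norm\<close>, so that one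
    computation yields both the integral and absolute integrability.\<close>
  have cong: "h (if s \<in> {0..T} then f s else 0) = (if s \<in> {0..m} then h (f s) else 0)"
    if "s \<in> {0..t}" "h 0 = 0" for s and h :: "real \<Rightarrow> real"
    using that by (auto simp: m_def)
  have I: "((\<lambda>s. h (if s \<in> {0..T} then f s else 0)) has_integral (integral {0..m} (\<lambda>s. h (f s)))) {0..t}"
    if "(\<lambda>s. h (f s)) integrable_on {0..m}" "h 0 = 0" for h :: "real \<Rightarrow> real"
  proof (rule has_integral_eq[rotated])
    show "((\<lambda>s. if s \<in> {0..m} then h (f s) else 0) has_integral (integral {0..m} (\<lambda>s. h (f s)))) {0..t}"
      unfolding has_integral_restrict[OF m(2)] using that(1) by (rule integrable_integral)
  qed (rule cong[symmetric], use that in auto)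
  note f = ac_primitive_onD[OF ac m(1)]
  have I1: "((\<lambda>s. if s \<in> {0..T} then f s else 0) has_integral (integral {0..m} f)) {0..t}"
    by (rule I[of "\<lambda>x. x"]) (use f in auto)
  have I2: "((\<lambda>s. norm (if s \<in> {0..T} then f s else 0)) has_integral (integral {0..m} (\<lambda>s. norm (f s)))) {0..t}"
    by (rule I[of norm]) (use f in \<open>auto simp: absolutely_integrable_on_def\<close>)
  show "(\<lambda>s. if s \<in> {0..T} then f s else 0) absolutely_integrable_on {0..t}"
    unfolding absolutely_integrable_on_def using I1 I2 by blast
  have "(if t \<in> {0..T} then x t else 0) = x m"
    using t \<open>x T = 0\<close> by (auto simp: m_def min_def)
  then show "(if t \<in> {0..T} then x t else 0) = (if 0 \<in> {0..T} then x 0 else 0)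
      + integral {0..t} (\<lambda>s. if s \<in> {0..T} then f s else 0)"
    using integral_unique[OF I1] f(1) T by simp
qed

lemma ac_primitive_const_imp_0:
  assumes ac: "ac_primitive_on {0..T} x f" and f: "continuous_on {0..T} f"
    and a: "0 \<le> a" "a < T" and x: "\<And>t. t \<in> {a..T} \<Longrightarrow> x t = c" and t: "t \<in> {a..T}"
  shows "f t = 0"
proof (rule vector_derivative_unique_within_closed_interval)
  show "a < T" "t \<in> cbox a T" using a t by auto
  have "(x has_real_derivative f t) (at t within {a..T})"
    by (rule DERIV_subset[OF ac_primitive_has_derivative[OF ac f]]) (use a t in auto)
  then show "(x has_vector_derivative f t) (at t within cbox a T)"
    by (simp add: has_real_derivative_iff_has_vector_derivative)
  have "((\<lambda>_. c) has_vector_derivative 0) (at t within cbox a T)"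
    by (rule has_vector_derivative_const)
  then show "(x has_vector_derivative 0) (at t within cbox a T)"
    by (rule has_vector_derivative_transform[rotated 2]) (use x t in auto)
qed

text \<open>Differentiating \<open>z = 0\<close> gives \<open>z1 = 0\<close> and then
  \<open>z2 = 0\<close>. The last step cannot differentiate, because \<open>z2\<close> is merely
  absolutely continuous; it uses that \<open>v\<close> has integral 0 over every
  subinterval.\<close>

lemma triple_integrator_0_imp_AE_0:
  assumes ti: "triple_integrator {0..T} z z1 z2 v"
    and a: "0 \<le> a" and z: "\<And>t. t \<in> {a..T} \<Longrightarrow> z t = 0"
  shows "AE t in lebesgue. t \<in> {a<..<T} \<longrightarrow> v t = 0"
proof (cases "a < T")
  case True
  have ac: "ac_primitive_on {0..T} z z1" "ac_primitive_on {0..T} z1 z2" "ac_primitive_on {0..T} z2 v"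
    using ti by (auto simp: triple_integrator_def)
  note cont = triple_integrator_continuous[OF ti]
  have z1: "z1 t = 0" if "t \<in> {a..T}" for t
    using ac_primitive_const_imp_0[OF ac(1) cont(2) a True z that] .
  have z2: "z2 t = 0" if "t \<in> {a..T}" for t
    using ac_primitive_const_imp_0[OF ac(2) cont(3) a True z1 that] .
  have "AE t in lebesgue. t \<in> {a..T} \<longrightarrow> v t = 0"
  proof (rule subinterval_integrals_0_imp_AE_0)
    show "v absolutely_integrable_on {a..T}"
      by (rule ac_primitive_absolutely_integrable[OF ac(3) a order_refl])
    show "(v has_integral 0) {s..t}" if "a \<le> s" "s \<le> t" "t \<le> T" for s t
      using ac_primitive_has_integral[OF ac(3), of s t] z2[of s] z2[of t] that a by simp
  qed
  then show ?thesis
    by eventually_elim auto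
qed auto

section \<open>One cell of the chattering arc\<close>

locale chattering_system =
  fixes \<alpha> \<tau>1 \<tau>inf \<beta>1 \<beta>2 \<beta>3 :: real
  assumes constants: "chattering_constants \<alpha> \<tau>1 \<tau>inf \<beta>1 \<beta>2 \<beta>3"
begin

lemma order: "0 < \<beta>1" "\<beta>1 < \<beta>2" "\<beta>2 < 1" "1 < \<beta>3" "0 < \<alpha>" "\<alpha> < 1" "0 < \<tau>1"
  and eq1: "(1 - 2 * (1 - \<beta>1) + 2 * (1 - \<beta>2)) * \<tau>1 = 1 - \<alpha>"
  and eq2: "(1 - 2 * (1 - \<beta>1) ^ 2 + 2 * (1 - \<beta>2) ^ 2) * \<tau>1 = 2"
  and eq3: "(1 - 2 * (1 - \<beta>1) ^ 3 + 2 * (1 - \<beta>2) ^ 3) * \<tau>1 = 3"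
  and eq4: "2 * (\<beta>1 + \<beta>2 + \<beta>3) + (\<alpha> ^ 2 - 1) * (\<beta>1 * \<beta>2 + \<beta>1 * \<beta>3 + \<beta>2 * \<beta>3) = 3"
  and eq5: "\<beta>1 + \<beta>2 + \<beta>3 - (\<beta>1 * \<beta>2 + \<beta>1 * \<beta>3 + \<beta>2 * \<beta>3)
       - \<beta>1 * \<beta>2 * \<beta>3 * (\<alpha> ^ 3 - 1) = 1"
  and \<tau>inf_eq: "\<tau>inf = \<tau>1 / (1 - \<alpha>)"
  using constants by (auto simp: chattering_constants_def)

text \<open>This is the size of the jump of \<open>p''\<close> relative to the length of the cell. The cubic with roots
  \<open>\<beta>\<^sub>j\<close> has slope \<open>\<alpha>\<^sup>2 (\<beta>\<^sub>1 \<beta>\<^sub>2 + \<beta>\<^sub>1 \<beta>\<^sub>3 + \<beta>\<^sub>2 \<beta>\<^sub>3) > 0\<close> at \<open>1\<close>, which keeps \<open>\<beta>\<^sub>3\<close> close to \<open>1\<close>.\<close>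

lemma jump_coeff_pos: "0 < 6 - 2 * (1 - \<alpha>) * (\<beta>1 + \<beta>2 + \<beta>3)"
proof -
  have "(1 - \<beta>1) * (1 - \<beta>2) - (\<beta>3 - 1) * ((1 - \<beta>1) + (1 - \<beta>2))
      = \<alpha>^2 * (\<beta>1 * \<beta>2 + \<beta>1 * \<beta>3 + \<beta>2 * \<beta>3)"
    using eq4 by (simp add: algebra_simps)
  also have "\<dots> > 0"
    using order by (intro mult_pos_pos add_pos_pos) auto
  finally have "(\<beta>3 - 1) * ((1 - \<beta>1) + (1 - \<beta>2)) < (1 - \<beta>1) * (1 - \<beta>2)" by simp
  also have "\<dots> \<le> (1 - \<beta>1) * ((1 - \<beta>1) + (1 - \<beta>2))"
    using order by (intro mult_left_mono) auto
  finally have "\<beta>3 - 1 < 1 - \<beta>1"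
    using order by (simp add: mult_less_cancel_right)
  then have 3: "\<beta>1 + \<beta>2 + \<beta>3 < 3" using order by simp
  have "(1 - \<alpha>) * (\<beta>1 + \<beta>2 + \<beta>3) \<le> 1 * (\<beta>1 + \<beta>2 + \<beta>3)"
    using order by (intro mult_right_mono) auto
  with 3 have "(1 - \<alpha>) * (\<beta>1 + \<beta>2 + \<beta>3) < 3"
    by simp
  then have "2 * ((1 - \<alpha>) * (\<beta>1 + \<beta>2 + \<beta>3)) < 2 * 3"
    by (rule mult_strict_left_mono) simp
  then show ?thesis
    unfolding mult.assoc[symmetric] by simp
qed

text \<open>The values are the signs of the cubic with roots \<open>a + \<beta>j * L\<close>. Its
  third root lies beyond the right end because \<beta>3 > 1, so the cell contains just two
  switches.\<close>

definition bang_cell :: "real \<Rightarrow> real \<Rightarrow> (real \<Rightarrow> real) \<Rightarrow> bool" where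
  "bang_cell a L v \<longleftrightarrow> (AE t in lebesgue.
     (a < t \<and> t < a + \<beta>1 * L \<longrightarrow> v t = -1) \<and>
     (a + \<beta>1 * L < t \<and> t < a + \<beta>2 * L \<longrightarrow> v t = 1) \<and>
     (a + \<beta>2 * L < t \<and> t < a + L \<longrightarrow> v t = -1))"

text \<open>With \<open>L = l * \<tau>1\<close> the end values of \<open>z2\<close>,
  \<open>z1\<close>, \<open>z\<close> reduce to the first three equations for the constants.
  Positivity is shown piece by piece: on the first from the explicit cubic, on the last by expanding
  backwards from the right end, where \<open>z\<close> and \<open>z1\<close> vanish and
  \<open>z2\<close> is positive, and on the middle one from the shape of \<open>z1\<close>.\<close>

lemma bang_cell_step:
  assumes ti: "triple_integrator {0..T} z z1 z2 v"
    and a: "0 \<le> a" "a + L \<le> T" "0 < L"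
    and z: "z a = 0" "z1 a = 0" "z2 a = L / \<tau>1"
    and v: "bang_cell a L v"
  shows "z (a + L) = 0" "z1 (a + L) = 0" "z2 (a + L) = \<alpha> * L / \<tau>1"
    "\<And>t. a < t \<Longrightarrow> t < a + L \<Longrightarrow> 0 < z t"
proof -
  define l b1 b2 b where "l = L / \<tau>1" and "b1 = a + \<beta>1 * L" and "b2 = a + \<beta>2 * L" and "b = a + L"
  have l: "0 < l" "L = l * \<tau>1" "z2 a = l" using a order z by (auto simp: l_def)
  have ord: "a < b1" "b1 < b2" "b2 < b" "0 \<le> b1" "b1 \<le> T" "0 \<le> b2" "b2 \<le> T" "b \<le> T" "a < b"
  proof -
    have L: "\<beta>1 * L < \<beta>2 * L" "\<beta>2 * L < L" "0 < \<beta>1 * L" using order a(3) by auto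
    show "a < b1" "b1 < b2" "b2 < b" "0 \<le> b1" "b1 \<le> T" "0 \<le> b2" "b2 \<le> T" "b \<le> T" "a < b"
      unfolding b1_def b2_def b_def using L a by linarith+
  qed
  have v1: "AE t in lebesgue. a < t \<and> t < b1 \<longrightarrow> v t = -1"
    and v2: "AE t in lebesgue. b1 < t \<and> t < b2 \<longrightarrow> v t = 1"
    and v3: "AE t in lebesgue. b2 < t \<and> t < b \<longrightarrow> v t = -1"
    using v unfolding bang_cell_def b1_def b2_def b_def by (auto elim: eventually_mono)
  have P1: "z2 t = l - (t - a)" "z1 t = l * (t - a) - (t - a)^2 / 2"
      "z t = l * (t - a)^2 / 2 - (t - a)^3 / 6" if "a \<le> t" "t \<le> b1" for t
    using triple_integrator_const[OF ti a(1) ord(5) v1 that] z l(3) by simp_all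
  note P2 = triple_integrator_const[OF ti ord(4,7) v2]
  note P3 = triple_integrator_const[OF ti ord(6,8) v3]
  have d: "b1 - a = \<beta>1 * L" "b2 - b1 = (\<beta>2 - \<beta>1) * L" "b - b2 = (1 - \<beta>2) * L"
    by (auto simp: b1_def b2_def b_def algebra_simps)
  have V1: "z2 b1 = l - \<beta>1 * L" "z1 b1 = l * (\<beta>1 * L) - (\<beta>1 * L)^2 / 2"
    "z b1 = l * (\<beta>1 * L)^2 / 2 - (\<beta>1 * L)^3 / 6"
    using P1[of b1] ord unfolding d by auto
  have V2: "z2 b2 = z2 b1 + (\<beta>2 - \<beta>1) * L"
    "z1 b2 = z1 b1 + z2 b1 * ((\<beta>2 - \<beta>1) * L) + ((\<beta>2 - \<beta>1) * L)^2 / 2"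
    "z b2 = z b1 + z1 b1 * ((\<beta>2 - \<beta>1) * L) + z2 b1 * ((\<beta>2 - \<beta>1) * L)^2 / 2 + ((\<beta>2 - \<beta>1) * L)^3 / 6"
    using P2[of b2] ord unfolding d by auto
  have V3: "z2 b = z2 b2 - (1 - \<beta>2) * L"
    "z1 b = z1 b2 + z2 b2 * ((1 - \<beta>2) * L) - ((1 - \<beta>2) * L)^2 / 2"
    "z b = z b2 + z1 b2 * ((1 - \<beta>2) * L) + z2 b2 * ((1 - \<beta>2) * L)^2 / 2 - ((1 - \<beta>2) * L)^3 / 6"
    using P3[of b] ord unfolding d by auto
  \<comment> \<open>The control is -1 plus a jump by 2 at \<open>b1\<close> and a jump by -2 at
    \<open>b2\<close>. The effect of a jump on the end state is a power of the time remaining after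
    it, which is where the powers of \<open>1 - \<beta>1\<close> and \<open>1 - \<beta>2\<close>
    come from.\<close>
  have "z2 b = l - L * (1 - 2 * (1 - \<beta>1) + 2 * (1 - \<beta>2))"
    unfolding V3 V2 V1 by (simp add: algebra_simps)
  also have "\<dots> = l - l * ((1 - 2 * (1 - \<beta>1) + 2 * (1 - \<beta>2)) * \<tau>1)"
    unfolding l(2) by (simp add: algebra_simps)
  also have "\<dots> = \<alpha> * l"
    unfolding eq1 by (simp add: algebra_simps)
  finally have e2: "z2 b = \<alpha> * l" .
  have "z1 b = l * L - L^2 / 2 * (1 - 2 * (1 - \<beta>1)^2 + 2 * (1 - \<beta>2)^2)"
    unfolding V3 V2 V1 by (simp add: field_simps power2_eq_square)
  also have "\<dots> = l * L - l * L / 2 * ((1 - 2 * (1 - \<beta>1)^2 + 2 * (1 - \<beta>2)^2) * \<tau>1)"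
    unfolding l(2) by (simp add: power2_eq_square)
  also have "\<dots> = 0"
    unfolding eq2 by simp
  finally have e1: "z1 b = 0" .
  have "z b = l * L^2 / 2 - L^3 / 6 * (1 - 2 * (1 - \<beta>1)^3 + 2 * (1 - \<beta>2)^3)"
    unfolding V3 V2 V1 by (simp add: field_simps power2_eq_square power3_eq_cube)
  also have "\<dots> = l * L^2 / 2 - l * L^2 / 6 * ((1 - 2 * (1 - \<beta>1)^3 + 2 * (1 - \<beta>2)^3) * \<tau>1)"
    unfolding l(2) by (simp add: power2_eq_square power3_eq_cube)
  also have "\<dots> = 0"
    unfolding eq3 by simp
  finally have e0: "z b = 0" .
  show "z (a + L) = 0" "z1 (a + L) = 0" "z2 (a + L) = \<alpha> * L / \<tau>1"
    using e0 e1 e2 by (auto simp: b_def l_def)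
  \<comment> \<open>This is the expansion around \<open>b\<close> instead of \<open>b2\<close>. All
    terms of \<open>z\<close> have the same sign there, so positivity can be read off.\<close>
  have Q3: "z1 t = - (\<alpha> * l * (b - t) + (b - t)^2 / 2)" "z t = \<alpha> * l * (b - t)^2 / 2 + (b - t)^3 / 6"
    if t: "b2 \<le> t" "t \<le> b" for t
  proof -
    have A: "z2 b2 = \<alpha> * l + (b - b2)" using P3(1)[of b] ord e2 by simp
    have B: "z1 b2 = - (\<alpha> * l * (b - b2) + (b - b2)^2 / 2)"
      using P3(2)[of b] ord e1 A by (simp add: field_simps power2_eq_square)
    have C: "z b2 = \<alpha> * l * (b - b2)^2 / 2 + (b - b2)^3 / 6"
      using P3(3)[of b] ord e0 A B by (simp add: field_simps power2_eq_square power3_eq_cube)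
    show "z1 t = - (\<alpha> * l * (b - t) + (b - t)^2 / 2)"
      using P3(2)[OF t] A B by (simp add: field_simps power2_eq_square)
    show "z t = \<alpha> * l * (b - t)^2 / 2 + (b - t)^3 / 6"
      using P3(3)[OF t] A B C by (simp add: field_simps power2_eq_square power3_eq_cube)
  qed
  have al: "0 < \<alpha> * l" using order l by simp
  have pos3: "0 < z t" if "b2 \<le> t" "t < b" for t
    using Q3(2)[of t] that al by (simp add: add_pos_pos)
  have neg: "z1 b2 < 0"
  proof -
    have "0 < \<alpha> * l * (b - b2) + (b - b2)^2 / 2"
      using mult_pos_pos[OF al, of "b - b2"] ord by (intro add_pos_pos) auto
    then show ?thesis using Q3(1)[of b2] ord by simp
  qed
  have int1: "(z1 has_integral (z t - z s)) {s..t}" if "b1 \<le> s" "s \<le> t" "t \<le> b2" for s t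
    by (rule ac_primitive_has_integral[of T z z1])
      (use ti that ord in \<open>auto simp: triple_integrator_def\<close>)
  \<comment> \<open>Since \<open>v\<close> is 1 on the middle piece, \<open>z1\<close> is a convex
    parabola there. Being negative at \<open>b2\<close>, it can change sign only from plus to
    minus.\<close>
  have conv: "z1 ((1 - w) * s + w * t) \<le> (1 - w) * z1 s + w * z1 t"
    if w: "0 \<le> w" "w \<le> 1" and st: "b1 \<le> s" "s \<le> b2" "b1 \<le> t" "t \<le> b2" for s t w
  proof -
    have "(1 - w) * b1 + w * b1 \<le> (1 - w) * s + w * t" "(1 - w) * s + w * t \<le> (1 - w) * b2 + w * b2"
      using w st by (auto intro!: add_mono mult_left_mono)
    then have r: "b1 \<le> (1 - w) * s + w * t" "(1 - w) * s + w * t \<le> b2"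
      by (auto simp: algebra_simps)
    have "(1 - w) * z1 s + w * z1 t - z1 ((1 - w) * s + w * t) = w * (1 - w) * (s - t)^2 / 2"
      unfolding P2(2)[OF r] P2(2)[OF st(1,2)] P2(2)[OF st(3,4)] by (simp add: field_simps power2_eq_square)
    also have "\<dots> \<ge> 0" using w by simp
    finally show ?thesis by simp
  qed
  have between: "\<exists>w. 0 \<le> w \<and> w \<le> 1 \<and> r = (1 - w) * s + w * t" if "s \<le> r" "r \<le> t" "s < t" for r s t :: real
  proof (intro exI[of _ "(r - s) / (t - s)"] conjI)
    have "(r - s) / (t - s) * (t - s) = r - s" using that by simp
    then show "r = (1 - (r - s) / (t - s)) * s + (r - s) / (t - s) * t" by (simp only: algebra_simps)
  qed (use that in auto)
  \<comment> \<open>Before the sign change of \<open>z1\<close> the function \<open>z\<close> has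
    only increased since \<open>b1\<close>; after it, \<open>z\<close> decreases towards the
    positive value \<open>z b2\<close>.\<close>
  have pos2': "(0 \<le> z1 t \<and> 0 \<le> z1 b1 \<and> z b1 \<le> z t) \<or> 0 < z t" if t: "b1 \<le> t" "t \<le> b2" for t
  proof (cases "0 \<le> z1 t")
    case True
    have "0 \<le> z1 s" if s: "b1 \<le> s" "s \<le> t" for s
    proof (rule ccontr)
      assume "\<not> 0 \<le> z1 s"
      then have "z1 s < 0" "s < b2" using True s t neg by (auto simp: order.order_iff_strict)
      moreover obtain w where w: "0 \<le> w" "w \<le> 1" "t = (1 - w) * s + w * b2"
        using between[of s t b2] s t \<open>s < b2\<close> by auto
      ultimately have "z1 t \<le> (1 - w) * z1 s + w * z1 b2"
        using conv[of w s b2] s t by auto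
      also have "\<dots> < 0"
      proof (cases "w = 1")
        case False
        then have "(1 - w) * z1 s < 0" "w * z1 b2 \<le> 0"
          using w neg \<open>z1 s < 0\<close> by (auto simp: mult_pos_neg mult_nonneg_nonpos)
        then show ?thesis by simp
      qed (use neg in simp)
      finally show False using True by simp
    qed
    moreover have "0 \<le> z t - z b1"
      by (rule has_integral_nonneg[OF int1[of b1 t]]) (use calculation t in auto)
    ultimately show ?thesis using t by auto
  next
    case False
    have "z1 s \<le> 0" if s: "t \<le> s" "s \<le> b2" for s
    proof (cases "t < b2")
      case True
      then obtain w where w: "0 \<le> w" "w \<le> 1" "s = (1 - w) * t + w * b2"
        using between[of t s b2] s by auto
      then have "z1 s \<le> (1 - w) * z1 t + w * z1 b2"
        using conv[of w t b2] t by auto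
      also have "\<dots> \<le> 0"
        using w False neg by (intro add_nonpos_nonpos mult_nonneg_nonpos) auto
      finally show ?thesis .
    next
      case False
      then have "s = b2" using s by simp
      then show ?thesis using neg by simp
    qed
    then have "0 \<le> - (z b2 - z t)"
      by (intro has_integral_nonneg[OF has_integral_neg[OF int1[of t b2]]]) (use t in auto)
    then show ?thesis using pos3[of b2] ord by auto
  qed
  \<comment> \<open>On the first piece \<open>z t\<close> is
    \<open>(t - a)^2 * (3 * l - (t - a)) / 6\<close>, so the claim amounts to
    \<open>b1 - a < 3 * l\<close>. If \<open>z1 b1\<close> is nonnegative, even
    \<open>b1 - a \<le> 2 * l\<close> holds; otherwise \<open>pos2'\<close> at \<open>b1\<close>
    leaves only its second alternative.\<close>
  have b1pos: "0 < z b1"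
  proof -
    have "0 < z b1" if "0 \<le> z1 b1"
    proof -
      have "0 \<le> (b1 - a) * (2 * l - (b1 - a))"
        using that P1(2)[of b1] ord by (simp add: field_simps power2_eq_square)
      then have "b1 - a < 3 * l" using ord l(1) by (simp add: zero_le_mult_iff)
      then have "0 < (b1 - a)^2 * (3 * l - (b1 - a))" using ord by simp
      then show ?thesis using P1(3)[of b1] ord by (simp add: field_simps power2_eq_square power3_eq_cube)
    qed
    then show ?thesis using pos2'[of b1] ord by auto
  qed
  have pos2: "0 < z t" if "b1 \<le> t" "t \<le> b2" for t
    using pos2'[OF that] b1pos by auto
  have pos1: "0 < z t" if t: "a < t" "t \<le> b1" for t
  proof -
    have "0 < (b1 - a)^2 * (3 * l - (b1 - a))"
      using b1pos P1(3)[of b1] ord by (simp add: field_simps power2_eq_square power3_eq_cube)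
    then have "b1 - a < 3 * l" using ord by (simp add: zero_less_mult_iff)
    then have "0 < (t - a)^2 * (3 * l - (t - a))" using t by simp
    then show ?thesis using P1(3)[of t] t by (simp add: field_simps power2_eq_square power3_eq_cube)
  qed
  show "0 < z t" if "a < t" "t < a + L" for t
    using pos1[of t] pos2[of t] pos3[of t] that by (cases "t \<le> b1"; cases "t \<le> b2") (auto simp: b_def)
qed


section \<open>The dual certificate\<close>

definition tau :: "nat \<Rightarrow> real" where "tau i = (1 - \<alpha> ^ i) / (1 - \<alpha>) * \<tau>1"

definition len :: "nat \<Rightarrow> real" where "len i = \<alpha> ^ i * \<tau>1"

lemma tau_0 [simp]: "tau 0 = 0"
  by (simp add: tau_def)

lemma len_0 [simp]: "len 0 = \<tau>1"
  by (simp add: len_def)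

lemma len_pos: "0 < len i"
  using order by (simp add: len_def)

lemma len_Suc: "len (Suc i) = \<alpha> * len i"
  by (simp add: len_def)

lemma tau_Suc: "tau (Suc i) = tau i + len i"
  using order by (simp add: tau_def len_def field_simps)

lemma tau_eq: "tau i = (1 - \<alpha> ^ i) * \<tau>inf"
  by (simp add: tau_def \<tau>inf_eq)

lemma \<tau>inf_pos: "0 < \<tau>inf"
  using order by (simp add: \<tau>inf_eq)

lemma strict_mono_tau: "strict_mono tau"
  by (rule strict_monoI_Suc) (simp add: tau_Suc len_pos)

lemma tau_nonneg: "0 \<le> tau i"
  using strict_mono_less_eq[OF strict_mono_tau, of 0 i] by simp

lemma tau_less: "tau i < \<tau>inf"
  using \<tau>inf_pos order by (simp add: tau_eq)

lemma tendsto_power_\<alpha>: "(\<lambda>i. \<alpha> ^ i) \<longlonglongrightarrow> 0"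
  using order by (intro LIMSEQ_power_zero) auto

lemma tendsto_tau: "tau \<longlonglongrightarrow> \<tau>inf"
proof -
  have "(\<lambda>i. (1 - \<alpha> ^ i) * \<tau>inf) \<longlonglongrightarrow> (1 - 0) * \<tau>inf"
    by (intro tendsto_intros tendsto_power_\<alpha>)
  then show ?thesis by (simp add: tau_eq[abs_def])
qed

lemma tendsto_len: "len \<longlonglongrightarrow> 0"
  unfolding len_def[abs_def] by (rule tendsto_mult_left_zero[OF tendsto_power_\<alpha>])

lemma tau_cover:
  assumes "0 \<le> t" "t < \<tau>inf"
  obtains i where "tau i \<le> t" "t < tau (Suc i)"
proof -
  obtain n where n: "t < tau n"
    using order_tendstoD(1)[OF tendsto_tau assms(2)] by (auto simp: eventually_sequentially)
  define m where "m = (LEAST n. t < tau n)"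
  have "t < tau m"
    unfolding m_def by (rule LeastI[of _ n]) (rule n)
  moreover from this obtain i where i: "m = Suc i"
    using assms(1) by (cases m) auto
  moreover have "\<not> t < tau i"
    using i not_less_Least[of i "\<lambda>n. t < tau n"] by (auto simp: m_def)
  ultimately show ?thesis
    using that[of i] by simp
qed

lemma bang_cells_state:
  assumes ti: "triple_integrator {0..T} z z1 z2 v" and init: "z 0 = 0" "z1 0 = 0" "z2 0 = 1"
    and "tau N \<le> T" and "\<And>i. i < N \<Longrightarrow> bang_cell (tau i) (len i) v"
  shows "z (tau N) = 0 \<and> z1 (tau N) = 0 \<and> z2 (tau N) = \<alpha> ^ N"
  using assms(5,6)
proof (induction N)
  case (Suc N)
  have T: "tau N + len N \<le> T" using Suc.prems(1) by (simp add: tau_Suc)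
  with len_pos[of N] Suc have *: "z (tau N) = 0" "z1 (tau N) = 0" "z2 (tau N) = \<alpha> ^ N"
    by auto
  then have "z2 (tau N) = len N / \<tau>1"
    using order by (simp add: len_def)
  from bang_cell_step(1-3)[OF ti tau_nonneg T len_pos *(1,2) this Suc.prems(2)[OF lessI]]
  show ?case
    using order by (simp add: tau_Suc len_def)
qed (use init in simp)

lemma bang_cells_pos:
  assumes ti: "triple_integrator {0..T} z z1 z2 v" and init: "z 0 = 0" "z1 0 = 0" "z2 0 = 1"
    and T: "tau (Suc N) \<le> T" and v: "\<And>i. i \<le> N \<Longrightarrow> bang_cell (tau i) (len i) v"
    and t: "tau N < t" "t < tau (Suc N)"
  shows "0 < z t"
proof -
  have T': "tau N + len N \<le> T" using T by (simp add: tau_Suc)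
  then have *: "z (tau N) = 0" "z1 (tau N) = 0" "z2 (tau N) = \<alpha> ^ N"
    using bang_cells_state[OF ti init, of N] v len_pos[of N] by auto
  then have "z2 (tau N) = len N / \<tau>1"
    using order by (simp add: len_def)
  from bang_cell_step(4)[OF ti tau_nonneg T' len_pos *(1,2) this v[OF order_refl] t(1)] t(2)
  show ?thesis by (simp add: tau_Suc)
qed

section \<open>The cubic on a single cell\<close>

abbreviation "e1 \<equiv> \<beta>1 + \<beta>2 + \<beta>3"
abbreviation "e2 \<equiv> \<beta>1 * \<beta>2 + \<beta>1 * \<beta>3 + \<beta>2 * \<beta>3"
abbreviation "e3 \<equiv> \<beta>1 * \<beta>2 * \<beta>3"

definition cert :: "real \<Rightarrow> real \<Rightarrow> real \<Rightarrow> real" where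
  "cert a L t = (t - (a + \<beta>1 * L)) * (t - (a + \<beta>2 * L)) * (t - (a + \<beta>3 * L))"

text \<open>The boundary term \<open>p x\<^sub>2 - p' x\<^sub>1 + p'' x\<^sub>0\<close> at the left end of a cell of length \<open>L\<close>.\<close>

definition bdry :: "real \<Rightarrow> real \<Rightarrow> real \<Rightarrow> real \<Rightarrow> real" where
  "bdry L x0 x1 x2 = - (e3 * L^3 * x2) - e2 * L^2 * x1 - 2 * e1 * L * x0"

text \<open>The duality gap of one cell. For controls bounded by 1 the integrand is nonnegative, and
  it vanishes where \<open>v\<close> agrees with the sign of the cubic.\<close>

definition defect :: "real \<Rightarrow> real \<Rightarrow> (real \<Rightarrow> real) \<Rightarrow> real" where
  "defect a L v = integral {a..a + L} (\<lambda>t. \<bar>cert a L t\<bar> - cert a L t * v t)"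

text \<open>The L1 norm of the cubic on the unit cell. On a cell of length \<open>L\<close> the
  cubic scales by \<open>L^3\<close> and the interval by \<open>L\<close>, hence the factor
  \<open>L^4\<close> later on.\<close>

definition mass :: real where "mass = integral {0..1} (\<lambda>t. \<bar>cert 0 1 t\<bar>)"

lemma continuous_on_cert: "continuous_on S (cert a L)"
  unfolding cert_def[abs_def] by (intro continuous_intros)

lemma has_integral_abs_cert:
  assumes L: "0 < L"
  shows "((\<lambda>t. \<bar>cert a L t\<bar>) has_integral (L^4 * mass)) {a..a + L}"
proof -
  have "((\<lambda>t. \<bar>cert 0 1 t\<bar>) has_integral mass) (cbox 0 1)"
    unfolding mass_def cbox_interval
    by (intro integrable_integral integrable_continuous_real continuous_intros continuous_on_cert)
  moreover have "(0 - - a / L) /\<^sub>R (1 / L) = a" "(1 - - a / L) /\<^sub>R (1 / L) = a + L"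
    using L by (auto simp: field_simps)
  ultimately have "((\<lambda>t. \<bar>cert 0 1 (t / L - a / L)\<bar>) has_integral (mass * L)) {a..a + L}"
    using has_integral_affinity'[of "\<lambda>t. \<bar>cert 0 1 t\<bar>" mass 0 1 "1 / L" "- a / L"] L
    by (simp add: mult.commute)
  from has_integral_mult_right[OF this, of "L^3"]
  have *: "((\<lambda>t. L^3 * \<bar>cert 0 1 (t / L - a / L)\<bar>) has_integral (L^4 * mass)) {a..a + L}"
    by (rule has_integral_eq_rhs) (simp add: eval_nat_numeral)
  have "cert a L t = L^3 * cert 0 1 (t / L - a / L)" for t
  proof -
    have E: "t - (a + \<beta> * L) = L * ((t / L - a / L) - (0 + \<beta> * 1))" for \<beta>
      using L by (simp add: field_simps)
    show ?thesis
      unfolding cert_def E by (simp only: power3_eq_cube ac_simps)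
  qed
  then have "\<bar>cert a L t\<bar> = L^3 * \<bar>cert 0 1 (t / L - a / L)\<bar>" for t
    using L by (simp add: abs_mult)
  with * show ?thesis by simp
qed

text \<open>The last two equations for the constants say that the unit cubic and its slope at 1 are
  \<alpha>^3 and \<alpha>^2 times those at 0. Thus the right end reproduces the boundary term of a
  cell of length \<open>\<alpha> * L\<close>, except in the second derivative; the mismatch is the
  coefficient of the extra \<open>z (a + L)\<close>.\<close>

lemma has_integral_cert_mult:
  assumes ti: "triple_integrator {0..T} z z1 z2 v"
    and a: "0 \<le> a" "a + L \<le> T" "0 < L"
    and v: "\<And>t. t \<in> {0..T} \<Longrightarrow> \<bar>v t\<bar> \<le> C"
  shows "((\<lambda>t. cert a L t * v t) has_integral
     (bdry (\<alpha> * L) (z (a + L)) (z1 (a + L)) (z2 (a + L)) + L * (6 - 2 * (1 - \<alpha>) * e1) * z (a + L)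
       - bdry L (z a) (z1 a) (z2 a) - 6 * integral {a..a + L} z)) {a..a + L}"
proof -
  define b where "b = a + L"
  have h3: "(1 - \<beta>1) * (1 - \<beta>2) * (1 - \<beta>3) = - (\<alpha>^3 * e3)"
    using eq5 by (simp add: algebra_simps)
  have h2: "(1 - \<beta>1) * (1 - \<beta>2) + (1 - \<beta>1) * (1 - \<beta>3) + (1 - \<beta>2) * (1 - \<beta>3) = \<alpha>^2 * e2"
    using eq4 by (simp add: algebra_simps)
  have d: "b - (a + \<beta> * L) = (1 - \<beta>) * L" "a - (a + \<beta> * L) = - \<beta> * L" for \<beta>
    by (simp_all add: b_def algebra_simps)
  have pb: "(b - (a + \<beta>1 * L)) * (b - (a + \<beta>2 * L)) * (b - (a + \<beta>3 * L)) = - (e3 * (\<alpha> * L)^3)"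
  proof -
    have "(b - (a + \<beta>1 * L)) * (b - (a + \<beta>2 * L)) * (b - (a + \<beta>3 * L))
       = ((1 - \<beta>1) * (1 - \<beta>2) * (1 - \<beta>3)) * L^3"
      unfolding d by (simp only: power3_eq_cube ac_simps)
    then show ?thesis unfolding h3 by (simp add: power_mult_distrib)
  qed
  have p'b: "(b - (a + \<beta>1 * L)) * (b - (a + \<beta>2 * L)) + (b - (a + \<beta>1 * L)) * (b - (a + \<beta>3 * L))
     + (b - (a + \<beta>2 * L)) * (b - (a + \<beta>3 * L)) = e2 * (\<alpha> * L)^2"
  proof -
    have "(b - (a + \<beta>1 * L)) * (b - (a + \<beta>2 * L)) + (b - (a + \<beta>1 * L)) * (b - (a + \<beta>3 * L))
     + (b - (a + \<beta>2 * L)) * (b - (a + \<beta>3 * L))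
       = ((1 - \<beta>1) * (1 - \<beta>2) + (1 - \<beta>1) * (1 - \<beta>3) + (1 - \<beta>2) * (1 - \<beta>3)) * L^2"
      unfolding d by (simp add: algebra_simps power2_eq_square)
    then show ?thesis unfolding h2 by (simp add: power_mult_distrib)
  qed
  have pa: "(a - (a + \<beta>1 * L)) * (a - (a + \<beta>2 * L)) * (a - (a + \<beta>3 * L)) = - (e3 * L^3)"
    unfolding d by (simp add: power3_eq_cube)
  have p'a: "(a - (a + \<beta>1 * L)) * (a - (a + \<beta>2 * L)) + (a - (a + \<beta>1 * L)) * (a - (a + \<beta>3 * L))
     + (a - (a + \<beta>2 * L)) * (a - (a + \<beta>3 * L)) = e2 * L^2"
    unfolding d by (simp add: algebra_simps power2_eq_square)
  have p''b: "6 * b - 2 * (a + \<beta>1 * L + (a + \<beta>2 * L) + (a + \<beta>3 * L)) = L * (6 - 2 * (1 - \<alpha>) * e1) - 2 * e1 * (\<alpha> * L)"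
    by (simp add: b_def algebra_simps)
  have p''a: "6 * a - 2 * (a + \<beta>1 * L + (a + \<beta>2 * L) + (a + \<beta>3 * L)) = - (2 * e1 * L)"
    by (simp add: algebra_simps)
  have ab: "a \<le> b" "b \<le> T" using a by (auto simp: b_def)
  note D = triple_integrator_cubic_duality[OF ti a(1) ab v, of "a + \<beta>1 * L" "a + \<beta>2 * L" "a + \<beta>3 * L"]
  show ?thesis
    unfolding cert_def b_def[symmetric]
  proof (rule has_integral_eq_rhs[OF D sym])
    show "(b - (a + \<beta>1 * L)) * (b - (a + \<beta>2 * L)) * (b - (a + \<beta>3 * L)) * z2 b -
      ((b - (a + \<beta>1 * L)) * (b - (a + \<beta>2 * L)) + (b - (a + \<beta>1 * L)) * (b - (a + \<beta>3 * L)) +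
       (b - (a + \<beta>2 * L)) * (b - (a + \<beta>3 * L))) * z1 b +
      (6 * b - 2 * (a + \<beta>1 * L + (a + \<beta>2 * L) + (a + \<beta>3 * L))) * z b -
      ((a - (a + \<beta>1 * L)) * (a - (a + \<beta>2 * L)) * (a - (a + \<beta>3 * L)) * z2 a -
      ((a - (a + \<beta>1 * L)) * (a - (a + \<beta>2 * L)) + (a - (a + \<beta>1 * L)) * (a - (a + \<beta>3 * L)) +
       (a - (a + \<beta>2 * L)) * (a - (a + \<beta>3 * L))) * z1 a +
      (6 * a - 2 * (a + \<beta>1 * L + (a + \<beta>2 * L) + (a + \<beta>3 * L))) * z a) - 6 * integral {a..b} z =
     bdry (\<alpha> * L) (z b) (z1 b) (z2 b) + L * (6 - 2 * (1 - \<alpha>) * e1) * z b - bdry L (z a) (z1 a) (z2 a)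
       - 6 * integral {a..b} z"
      unfolding pb p'b pa p'a p''b p''a bdry_def by (simp add: algebra_simps)
  qed simp
qed

lemma cell_duality:
  assumes ti: "triple_integrator {0..T} z z1 z2 v"
    and a: "0 \<le> a" "a + L \<le> T" "0 < L"
    and v: "\<And>t. t \<in> {0..T} \<Longrightarrow> \<bar>v t\<bar> \<le> C"
  shows "6 * integral {a..a + L} z =
     bdry (\<alpha> * L) (z (a + L)) (z1 (a + L)) (z2 (a + L)) - bdry L (z a) (z1 a) (z2 a)
     + (L * (6 - 2 * (1 - \<alpha>) * e1) * z (a + L) + defect a L v) - L^4 * mass"
  using integral_unique[OF has_integral_diff[OF has_integral_abs_cert[OF a(3), of a] has_integral_cert_mult[OF ti a v]]]
  unfolding defect_def by simp

lemma cert_sign: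
  assumes "0 < L"
  shows "a \<le> t \<Longrightarrow> t < a + \<beta>1 * L \<Longrightarrow> cert a L t < 0"
    "a + \<beta>1 * L < t \<Longrightarrow> t < a + \<beta>2 * L \<Longrightarrow> 0 < cert a L t"
    "a + \<beta>2 * L < t \<Longrightarrow> t \<le> a + L \<Longrightarrow> cert a L t < 0"
proof -
  have "\<beta>1 * L < \<beta>2 * L" "\<beta>2 * L < L" "L < \<beta>3 * L"
    using order assms by auto
  note L = this
  show "cert a L t < 0" if "a \<le> t" "t < a + \<beta>1 * L"
    unfolding cert_def by (rule mult_pos_neg[OF mult_neg_neg]) (use that L in linarith)+
  show "0 < cert a L t" if "a + \<beta>1 * L < t" "t < a + \<beta>2 * L"
    unfolding cert_def by (rule mult_neg_neg[OF mult_pos_neg]) (use that L in linarith)+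
  show "cert a L t < 0" if "a + \<beta>2 * L < t" "t \<le> a + L"
    unfolding cert_def by (rule mult_pos_neg[OF mult_pos_pos]) (use that L in linarith)+
qed

lemma defect_integrand_nonneg: "\<bar>v t\<bar> \<le> 1 \<Longrightarrow> 0 \<le> \<bar>cert a L t\<bar> - cert a L t * v t"
  using mult_left_mono[of "\<bar>v t\<bar>" 1 "\<bar>cert a L t\<bar>"] abs_ge_self[of "cert a L t * v t"]
  by (simp add: abs_mult)

lemma defect_integrand_integrable:
  assumes ti: "triple_integrator {0..T} z z1 z2 v"
    and a: "0 \<le> a" "a + L \<le> T" "0 < L"
    and v: "\<And>t. t \<in> {0..T} \<Longrightarrow> \<bar>v t\<bar> \<le> 1"
  shows "(\<lambda>t. \<bar>cert a L t\<bar> - cert a L t * v t) absolutely_integrable_on {a..a + L}"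
proof (rule nonnegative_absolutely_integrable_1)
  show "(\<lambda>t. \<bar>cert a L t\<bar> - cert a L t * v t) integrable_on {a..a + L}"
    using has_integral_diff[OF has_integral_abs_cert[OF a(3), of a] has_integral_cert_mult[OF ti a v]]
    by (rule has_integral_integrable)
qed (rule defect_integrand_nonneg, rule v, use a in simp)

lemma defect_nonneg:
  assumes ti: "triple_integrator {0..T} z z1 z2 v"
    and a: "0 \<le> a" "a + L \<le> T" "0 < L"
    and v: "\<And>t. t \<in> {0..T} \<Longrightarrow> \<bar>v t\<bar> \<le> 1"
  shows "0 \<le> defect a L v"
proof -
  have "(\<lambda>t. \<bar>cert a L t\<bar> - cert a L t * v t) integrable_on {a..a + L}"
    by (rule set_lebesgue_integral_eq_integral(1)[OF defect_integrand_integrable[OF ti a v]])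
  then show ?thesis
    unfolding defect_def by (rule integral_nonneg) (rule defect_integrand_nonneg, rule v, use a in simp)
qed

lemma defect_0_imp_bang_cell:
  assumes ti: "triple_integrator {0..T} z z1 z2 v"
    and a: "0 \<le> a" "a + L \<le> T" "0 < L"
    and v: "\<And>t. t \<in> {0..T} \<Longrightarrow> \<bar>v t\<bar> \<le> 1"
    and 0: "defect a L v = 0"
  shows "bang_cell a L v"
proof -
  have L: "0 < \<beta>1 * L" "\<beta>1 * L < \<beta>2 * L" "\<beta>2 * L < L"
    using order a(3) by auto
  have "AE t in lebesgue. t \<in> {a..a + L} \<longrightarrow> \<bar>cert a L t\<bar> - cert a L t * v t = 0"
  proof (rule integral_nonneg_0_imp_AE[OF defect_integrand_integrable[OF ti a v]])
    show "0 \<le> \<bar>cert a L t\<bar> - cert a L t * v t" if "t \<in> {a..a + L}" for t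
      by (rule defect_integrand_nonneg, rule v) (use a that in simp)
  qed (use 0 in \<open>simp_all add: defect_def\<close>)
  then show ?thesis
    unfolding bang_cell_def
  proof eventually_elim
    case (elim t)
    have neg: "v t = -1" if "cert a L t < 0" "t \<in> {a..a + L}"
    proof -
      have "cert a L t * (v t + 1) = 0" using that elim by (simp add: algebra_simps)
      then show ?thesis using that by simp
    qed
    have pos: "v t = 1" if "0 < cert a L t" "t \<in> {a..a + L}"
    proof -
      have "cert a L t * (v t - 1) = 0" using that elim by (simp add: algebra_simps)
      then show ?thesis using that by simp
    qed
    show ?case
    proof (intro conjI impI)
      assume t: "a < t \<and> t < a + \<beta>1 * L"
      show "v t = -1" by (rule neg[OF cert_sign(1)[OF a(3)]]) (use t L in auto)
    next
      assume t: "a + \<beta>1 * L < t \<and> t < a + \<beta>2 * L"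
      show "v t = 1" by (rule pos[OF cert_sign(2)[OF a(3)]]) (use t L in auto)
    next
      assume t: "a + \<beta>2 * L < t \<and> t < a + L"
      show "v t = -1" by (rule neg[OF cert_sign(3)[OF a(3)]]) (use t L in auto)
    qed
  qed
qed

lemma bang_cell_imp_defect_0:
  assumes L: "0 < L" and v: "bang_cell a L v"
  shows "defect a L v = 0"
proof -
  obtain N where N: "negligible N" "{t. \<not> (
     (a < t \<and> t < a + \<beta>1 * L \<longrightarrow> v t = -1) \<and>
     (a + \<beta>1 * L < t \<and> t < a + \<beta>2 * L \<longrightarrow> v t = 1) \<and>
     (a + \<beta>2 * L < t \<and> t < a + L \<longrightarrow> v t = -1))} \<subseteq> N"
    using v unfolding bang_cell_def eventually_ae_filter_negligible by blast
  have "((\<lambda>t. \<bar>cert a L t\<bar> - cert a L t * v t) has_integral 0) {a..a + L}"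
  proof (rule has_integral_spike[OF _ _ has_integral_0])
    show "negligible (N \<union> {a, a + \<beta>1 * L, a + \<beta>2 * L, a + L})"
      using N(1) by (intro negligible_Un) auto
    fix t assume t: "t \<in> {a..a + L} - (N \<union> {a, a + \<beta>1 * L, a + \<beta>2 * L, a + L})"
    with N(2) have *: "a < t \<and> t < a + \<beta>1 * L \<longrightarrow> v t = -1"
      "a + \<beta>1 * L < t \<and> t < a + \<beta>2 * L \<longrightarrow> v t = 1"
      "a + \<beta>2 * L < t \<and> t < a + L \<longrightarrow> v t = -1"
      by blast+
    consider "a < t" "t < a + \<beta>1 * L" | "a + \<beta>1 * L < t" "t < a + \<beta>2 * L" | "a + \<beta>2 * L < t" "t < a + L"
      using t by force
    then show "\<bar>cert a L t\<bar> - cert a L t * v t = 0"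
    proof cases
      case 1
      then show ?thesis using cert_sign(1)[OF L, of a t] * by simp
    next
      case 2
      then show ?thesis using cert_sign(2)[OF L, of a t] * by simp
    next
      case 3
      then show ?thesis using cert_sign(3)[OF L, of a t] * by simp
    qed
  qed
  then show ?thesis
    unfolding defect_def by (rule integral_unique)
qed

text \<open>The boundary terms telescope, because the next cell has length
  \<open>\<alpha> * len i\<close>. The initial state \<open>(1, 0, 0)\<close> contributes
  \<open>e3 * \<tau>1^3\<close>.\<close>

lemma sum_duality:
  assumes ti: "triple_integrator {0..T} z z1 z2 v" and init: "z 0 = 0" "z1 0 = 0" "z2 0 = 1"
    and v: "\<And>t. t \<in> {0..T} \<Longrightarrow> \<bar>v t\<bar> \<le> C"
    and "tau N \<le> T"
  shows "6 * integral {0..tau N} z = bdry (len N) (z (tau N)) (z1 (tau N)) (z2 (tau N)) + e3 * \<tau>1^3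
     + (\<Sum>i<N. len i * (6 - 2 * (1 - \<alpha>) * e1) * z (tau (Suc i)) + defect (tau i) (len i) v)
     - mass * (\<Sum>i<N. len i ^ 4)"
  using \<open>tau N \<le> T\<close>
proof (induction N)
  case 0
  then show ?case using init by (simp add: bdry_def)
next
  case (Suc N)
  have T: "tau N + len N \<le> T" using Suc.prems by (simp add: tau_Suc)
  have "z integrable_on {0..tau (Suc N)}"
    using Suc.prems
    by (intro integrable_continuous_real continuous_on_subset[OF triple_integrator_continuous(1)[OF ti]]) auto
  then have "integral {0..tau N} z + integral {tau N..tau (Suc N)} z = integral {0..tau (Suc N)} z"
    by (intro Henstock_Kurzweil_Integration.integral_combine) (auto simp: tau_nonneg tau_Suc less_imp_le[OF len_pos])
  moreover have "6 * integral {tau N..tau (Suc N)} z =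
     bdry (len (Suc N)) (z (tau (Suc N))) (z1 (tau (Suc N))) (z2 (tau (Suc N)))
     - bdry (len N) (z (tau N)) (z1 (tau N)) (z2 (tau N))
     + (len N * (6 - 2 * (1 - \<alpha>) * e1) * z (tau (Suc N)) + defect (tau N) (len N) v) - len N^4 * mass"
    using cell_duality[OF ti tau_nonneg T len_pos v] unfolding tau_Suc len_Suc by simp
  moreover have "tau N \<le> T" using T len_pos[of N] by simp
  ultimately show ?case
    using Suc.IH unfolding sum.lessThan_Suc distrib_left[of mass] mult.commute[of mass "len N ^ 4"] by linarith
qed

text \<open>The limit of the right-hand side of \<open>sum_duality\<close> without the jump and gap
  terms: the boundary term disappears and the fourth powers of the lengths form a geometric
  series.\<close>

definition Jopt :: real where
  "Jopt = (e3 * \<tau>1^3 - mass * (\<tau>1^4 / (1 - \<alpha>^4))) / 6"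

lemma sum_len4: "(\<Sum>i<N. len i ^ 4) = \<tau>1^4 / (1 - \<alpha>^4) * (1 - \<alpha>^(4 * N))"
proof -
  have "\<alpha>^4 < 1" using order by (intro power_less_one_iff[THEN iffD2]) auto
  have "(\<Sum>i<N. len i ^ 4) = \<tau>1^4 * (\<Sum>i<N. (\<alpha>^4)^i)"
    by (simp add: len_def power_mult_distrib sum_distrib_left mult.commute power_mult[symmetric])
  also have "(\<Sum>i<N. (\<alpha>^4)^i) = (1 - (\<alpha>^4)^N) / (1 - \<alpha>^4)"
    using sum_gp_strict[of "\<alpha>^4" N] \<open>\<alpha>^4 < 1\<close> by simp
  finally show ?thesis
    by (simp add: power_mult)
qed

text \<open>All jump and gap terms vanish. The remaining boundary term is proportional to
  \<open>len N ^ 3 * \<alpha> ^ N\<close>, so it carries the same factor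
  \<open>\<alpha>^(4 * N)\<close> as the tail of the geometric series.\<close>

lemma bang_cells_cost:
  assumes ti: "triple_integrator {0..T} z z1 z2 v" and init: "z 0 = 0" "z1 0 = 0" "z2 0 = 1"
    and v: "\<And>t. t \<in> {0..T} \<Longrightarrow> \<bar>v t\<bar> \<le> C"
    and T: "tau N \<le> T" and bang: "\<And>i. i < N \<Longrightarrow> bang_cell (tau i) (len i) v"
  shows "integral {0..tau N} z = (1 - \<alpha>^(4 * N)) * Jopt"
proof -
  have st: "z (tau i) = 0 \<and> z1 (tau i) = 0 \<and> z2 (tau i) = \<alpha> ^ i" if "i \<le> N" for i
  proof (rule bang_cells_state[OF ti init])
    show "tau i \<le> T" using strict_mono_less_eq[OF strict_mono_tau, of i N] that T by simp
  qed (use bang that in auto)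
  have "(\<Sum>i<N. len i * (6 - 2 * (1 - \<alpha>) * e1) * z (tau (Suc i)) + defect (tau i) (len i) v) = 0"
    using bang_cell_imp_defect_0[OF len_pos bang] st by (intro sum.neutral) auto
  moreover have "bdry (len N) (z (tau N)) (z1 (tau N)) (z2 (tau N)) = - (e3 * \<tau>1^3 * \<alpha>^(4 * N))"
    using st[of N] by (simp add: bdry_def len_def power_mult_distrib power_mult[symmetric] power_add[symmetric] mult.commute)
  ultimately have "6 * integral {0..tau N} z = - (e3 * \<tau>1^3 * \<alpha>^(4 * N)) + e3 * \<tau>1^3
     - mass * (\<tau>1^4 / (1 - \<alpha>^4) * (1 - \<alpha>^(4 * N)))"
    using sum_duality[OF ti init v T] sum_len4 by simp
  moreover have J: "6 * Jopt = e3 * \<tau>1^3 - mass * (\<tau>1^4 / (1 - \<alpha>^4))"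
    by (simp add: Jopt_def)
  ultimately have "6 * integral {0..tau N} z = (1 - \<alpha>^(4 * N)) * (6 * Jopt)"
    unfolding J by (simp only: algebra_simps)
  then show ?thesis by simp
qed

lemma tendsto_integral_tau:
  fixes z :: "real \<Rightarrow> real"
  assumes "z integrable_on {0..\<tau>inf}"
  shows "(\<lambda>N. integral {0..tau N} z) \<longlonglongrightarrow> integral {0..\<tau>inf} z"
  by (rule continuous_on_tendsto_compose[OF indefinite_integral_continuous_1[OF assms] tendsto_tau])
    (use \<tau>inf_pos tau_nonneg tau_less in \<open>auto intro!: always_eventually less_imp_le\<close>)

lemma bang_cells_total_cost:
  assumes ti: "triple_integrator {0..T} z z1 z2 v" and init: "z 0 = 0" "z1 0 = 0" "z2 0 = 1"
    and v: "\<And>t. t \<in> {0..T} \<Longrightarrow> \<bar>v t\<bar> \<le> C"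
    and T: "\<tau>inf \<le> T" and bang: "\<And>i. bang_cell (tau i) (len i) v"
  shows "integral {0..\<tau>inf} z = Jopt"
proof (rule LIMSEQ_unique)
  show "(\<lambda>N. integral {0..tau N} z) \<longlonglongrightarrow> integral {0..\<tau>inf} z"
    using T by (intro tendsto_integral_tau integrable_continuous_real
        continuous_on_subset[OF triple_integrator_continuous(1)[OF ti]]) auto
  have "integral {0..tau N} z = (1 - (\<alpha>^N)^4) * Jopt" for N
    using bang_cells_cost[OF ti init v _ bang, of N] tau_less[of N] T by (simp add: power_mult[symmetric] mult.commute)
  moreover have "(\<lambda>N. (1 - (\<alpha>^N)^4) * Jopt) \<longlonglongrightarrow> (1 - 0^4) * Jopt"
    by (intro tendsto_intros tendsto_power_\<alpha>)
  ultimately show "(\<lambda>N. integral {0..tau N} z) \<longlonglongrightarrow> Jopt"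
    by simp
qed

text \<open>In \<open>sum_duality\<close> every jump and gap term is nonnegative; all are discarded
  except the gap of cell \<open>j\<close>. Then \<open>N\<close> tends to infinity: each boundary
  term contains a positive power of \<open>len N\<close>, and the states converge by continuity at
  \<open>\<tau>inf\<close>. The retained gap is what later forces the control.\<close>

lemma cost_lower_bound:
  assumes ti: "triple_integrator {0..T} z z1 z2 v" and init: "z 0 = 0" "z1 0 = 0" "z2 0 = 1"
    and v: "\<And>t. t \<in> {0..T} \<Longrightarrow> \<bar>v t\<bar> \<le> 1" and z: "\<And>t. t \<in> {0..T} \<Longrightarrow> 0 \<le> z t"
    and T: "\<tau>inf \<le> T"
  shows "Jopt + defect (tau j) (len j) v / 6 \<le> integral {0..\<tau>inf} z"
proof -
  have tT: "tau i \<le> T" for i using tau_less[of i] T by simp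
  have tT': "tau i + len i \<le> T" for i using tT[of "Suc i"] by (simp add: tau_Suc)
  have D0: "0 \<le> defect (tau i) (len i) v" for i
    by (rule defect_nonneg[OF ti tau_nonneg tT' len_pos v])
  define B where "B N = bdry (len N) (z (tau N)) (z1 (tau N)) (z2 (tau N)) + e3 * \<tau>1^3
     + defect (tau j) (len j) v - mass * (\<tau>1^4 / (1 - \<alpha>^4) * (1 - (\<alpha>^N)^4))" for N
  have le: "B N \<le> 6 * integral {0..tau N} z" if "N > j" for N
  proof -
    have t0: "0 \<le> len i * (6 - 2 * (1 - \<alpha>) * e1) * z (tau (Suc i))" for i
      using len_pos[of i] jump_coeff_pos z[of "tau (Suc i)"] tT tau_nonneg
      by (intro mult_nonneg_nonneg) auto
    have "defect (tau j) (len j) v \<le>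
        len j * (6 - 2 * (1 - \<alpha>) * e1) * z (tau (Suc j)) + defect (tau j) (len j) v"
      using t0 by simp
    also have "\<dots> \<le> (\<Sum>i<N. len i * (6 - 2 * (1 - \<alpha>) * e1) * z (tau (Suc i)) + defect (tau i) (len i) v)"
      using that t0 D0 by (intro member_le_sum) auto
    finally have "defect (tau j) (len j) v \<le>
        (\<Sum>i<N. len i * (6 - 2 * (1 - \<alpha>) * e1) * z (tau (Suc i)) + defect (tau i) (len i) v)" .
    moreover have "6 * integral {0..tau N} z = bdry (len N) (z (tau N)) (z1 (tau N)) (z2 (tau N)) + e3 * \<tau>1^3
       + (\<Sum>i<N. len i * (6 - 2 * (1 - \<alpha>) * e1) * z (tau (Suc i)) + defect (tau i) (len i) v)
       - mass * (\<Sum>i<N. len i ^ 4)"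
      by (rule sum_duality[OF ti init v tT])
    ultimately show ?thesis
      unfolding B_def sum_len4 power_mult[symmetric] mult.commute[of N 4] by linarith
  qed
  have lim: "(\<lambda>N. f (tau N)) \<longlonglongrightarrow> f \<tau>inf" if "continuous_on {0..T} f" for f :: "real \<Rightarrow> real"
    by (rule continuous_on_tendsto_compose[OF that tendsto_tau])
      (use \<tau>inf_pos T tau_nonneg tT in auto)
  note cont = triple_integrator_continuous[OF ti]
  have "B \<longlonglongrightarrow> (- (e3 * 0^3 * z2 \<tau>inf) - e2 * 0^2 * z1 \<tau>inf - 2 * e1 * 0 * z \<tau>inf) + e3 * \<tau>1^3
     + defect (tau j) (len j) v - mass * (\<tau>1^4 / (1 - \<alpha>^4) * (1 - 0^4))"
    unfolding B_def[abs_def] bdry_def 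
    by (intro tendsto_intros tendsto_len tendsto_power_\<alpha> lim[OF cont(1)] lim[OF cont(2)] lim[OF cont(3)])
  moreover have "(- (e3 * 0^3 * z2 \<tau>inf) - e2 * 0^2 * z1 \<tau>inf - 2 * e1 * 0 * z \<tau>inf) + e3 * \<tau>1^3
     + defect (tau j) (len j) v - mass * (\<tau>1^4 / (1 - \<alpha>^4) * (1 - 0^4))
     = 6 * (Jopt + defect (tau j) (len j) v / 6)"
    by (simp add: Jopt_def)
  ultimately have "B \<longlonglongrightarrow> 6 * (Jopt + defect (tau j) (len j) v / 6)"
    by metis
  moreover have "(\<lambda>N. 6 * integral {0..tau N} z) \<longlonglongrightarrow> 6 * integral {0..\<tau>inf} z"
    using T by (intro tendsto_intros tendsto_integral_tau integrable_continuous_real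
        continuous_on_subset[OF cont(1)]) auto
  ultimately have "6 * (Jopt + defect (tau j) (len j) v / 6) \<le> 6 * integral {0..\<tau>inf} z"
    by (rule LIMSEQ_le) (use le in \<open>auto intro!: exI[of _ "Suc j"]\<close>)
  then show ?thesis by simp
qed

lemma optimal_imp_bang_cell:
  assumes ti: "triple_integrator {0..T} z z1 z2 v" and init: "z 0 = 0" "z1 0 = 0" "z2 0 = 1"
    and v: "\<And>t. t \<in> {0..T} \<Longrightarrow> \<bar>v t\<bar> \<le> 1" and z: "\<And>t. t \<in> {0..T} \<Longrightarrow> 0 \<le> z t"
    and T: "\<tau>inf \<le> T" and le: "integral {0..\<tau>inf} z \<le> Jopt"
  shows "bang_cell (tau j) (len j) v"
proof -
  have T': "tau j + len j \<le> T" using tau_less[of "Suc j"] T by (simp add: tau_Suc)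
  have 0: "defect (tau j) (len j) v = 0"
    using cost_lower_bound[OF ti init v z T, of j] le defect_nonneg[OF ti tau_nonneg T' len_pos v] by simp
  show ?thesis
    by (rule defect_0_imp_bang_cell[OF ti tau_nonneg T' len_pos v 0])
qed


section \<open>Optimal value of problem (R)\<close>

definition bang_neg :: "real set" where
  "bang_neg = (\<Union>i. {tau i<..<tau i + \<beta>1 * len i} \<union> {tau i + \<beta>2 * len i<..<tau i + len i})"

definition bang_pos :: "real set" where
  "bang_pos = (\<Union>i. {tau i + \<beta>1 * len i<..<tau i + \<beta>2 * len i})"

text \<open>Built from countable unions of open intervals so that Borel measurability is immediate.
  At the nodes, at the switching points and from \<open>\<tau>inf\<close> on the value is 0.\<close>

definition vopt :: "real \<Rightarrow> real" where
  "vopt t = indicator bang_pos t - indicator bang_neg t"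

definition zopt2 :: "real \<Rightarrow> real" where "zopt2 t = 1 + integral {0..t} vopt"
definition zopt1 :: "real \<Rightarrow> real" where "zopt1 t = integral {0..t} zopt2"
definition zopt :: "real \<Rightarrow> real" where "zopt t = integral {0..t} zopt1"

lemma tau_cell_unique:
  assumes "tau i < t" "t < tau i + len i" "tau j < t" "t < tau j + len j"
  shows "i = j"
proof -
  have "i < Suc j" "j < Suc i"
    using strict_mono_less[OF strict_mono_tau, of i "Suc j"] strict_mono_less[OF strict_mono_tau, of j "Suc i"] assms
    by (auto simp: tau_Suc)
  then show ?thesis by simp
qed

lemma cell_order: "0 < \<beta>1 * len i" "\<beta>1 * len i < \<beta>2 * len i" "\<beta>2 * len i < len i"
  using order len_pos[of i] by auto

lemma vopt_cell:
  shows "tau i < t \<Longrightarrow> t < tau i + \<beta>1 * len i \<Longrightarrow> vopt t = -1"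
    "tau i + \<beta>1 * len i < t \<Longrightarrow> t < tau i + \<beta>2 * len i \<Longrightarrow> vopt t = 1"
    "tau i + \<beta>2 * len i < t \<Longrightarrow> t < tau i + len i \<Longrightarrow> vopt t = -1"
proof -
  have uniq: "j = i" if "tau i < t" "t < tau i + len i" "tau j < t" "t < tau j + len j" for j
    using tau_cell_unique[of j t i] that by simp
  have neg: "t \<in> bang_neg \<longleftrightarrow> t < tau i + \<beta>1 * len i \<or> tau i + \<beta>2 * len i < t"
    and pos: "t \<in> bang_pos \<longleftrightarrow> tau i + \<beta>1 * len i < t \<and> t < tau i + \<beta>2 * len i"
    if t: "tau i < t" "t < tau i + len i"
  proof -
    show "t \<in> bang_neg \<longleftrightarrow> t < tau i + \<beta>1 * len i \<or> tau i + \<beta>2 * len i < t"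
    proof
      assume "t \<in> bang_neg"
      then obtain j where j: "tau j < t \<and> t < tau j + \<beta>1 * len j \<or> tau j + \<beta>2 * len j < t \<and> t < tau j + len j"
        by (auto simp: bang_neg_def)
      have "j = i" by (rule uniq[OF t]) (use j cell_order[of j] in auto)
      then show "t < tau i + \<beta>1 * len i \<or> tau i + \<beta>2 * len i < t" using j by auto
    qed (use t in \<open>auto simp: bang_neg_def\<close>)
    show "t \<in> bang_pos \<longleftrightarrow> tau i + \<beta>1 * len i < t \<and> t < tau i + \<beta>2 * len i"
    proof
      assume "t \<in> bang_pos"
      then obtain j where j: "tau j + \<beta>1 * len j < t" "t < tau j + \<beta>2 * len j"
        by (auto simp: bang_pos_def)
      have "j = i" by (rule uniq[OF t]) (use j cell_order[of j] in auto)
      then show "tau i + \<beta>1 * len i < t \<and> t < tau i + \<beta>2 * len i" using j by auto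
    qed (auto simp: bang_pos_def)
  qed
  show "tau i < t \<Longrightarrow> t < tau i + \<beta>1 * len i \<Longrightarrow> vopt t = -1"
    "tau i + \<beta>1 * len i < t \<Longrightarrow> t < tau i + \<beta>2 * len i \<Longrightarrow> vopt t = 1"
    "tau i + \<beta>2 * len i < t \<Longrightarrow> t < tau i + len i \<Longrightarrow> vopt t = -1"
    using neg pos cell_order[of i] by (auto simp: vopt_def indicator_def)
qed

lemma vopt_after: "\<tau>inf \<le> t \<Longrightarrow> vopt t = 0"
proof -
  assume t: "\<tau>inf \<le> t"
  have lt: "tau i + len i < t" for i
    using tau_less[of "Suc i"] t by (simp add: tau_Suc)
  have "\<not> t < tau i + \<beta>1 * len i" "\<not> t < tau i + \<beta>2 * len i" "\<not> t < tau i + len i" for i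
    using lt[of i] cell_order[of i] by auto
  then have "t \<notin> bang_neg" "t \<notin> bang_pos"
    by (auto simp: bang_neg_def bang_pos_def)
  then show ?thesis by (simp add: vopt_def)
qed

lemma abs_vopt_le: "\<bar>vopt t\<bar> \<le> 1"
  by (simp add: vopt_def indicator_def)

lemma bang_cell_vopt: "bang_cell (tau i) (len i) vopt"
  unfolding bang_cell_def using vopt_cell by (intro AE_I2) auto

lemma vopt_absolutely_integrable: "vopt absolutely_integrable_on {0..t}"
proof -
  have "bang_pos \<in> sets borel" "bang_neg \<in> sets borel"
    unfolding bang_pos_def bang_neg_def by measurable
  then have "vopt \<in> borel_measurable borel"
    unfolding vopt_def[abs_def] by measurable
  then have "vopt \<in> borel_measurable lebesgue"
    by (simp add: measurable_completion)
  then have "vopt \<in> borel_measurable (lebesgue_on {0..t})"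
    by (rule measurable_restrict_space1)
  moreover have "bounded (vopt ` {0..t})"
    using abs_vopt_le by (auto simp: bounded_iff)
  \<comment> \<open>The factor 1 brings the claim into the form of a bounded measurable function
    times an integrable one.\<close>
  ultimately have "(\<lambda>s. vopt s * 1) absolutely_integrable_on {0..t}"
    by (intro absolutely_integrable_bounded_measurable_product_real[of vopt]) auto
  then show ?thesis by simp
qed

lemma triple_integrator_zopt: "triple_integrator {0..} zopt zopt1 zopt2 vopt"
proof -
  have ac2: "ac_primitive_on {0..} zopt2 vopt"
    using vopt_absolutely_integrable by (simp add: ac_primitive_on_def zopt2_def)
  have c2: "continuous_on {0..T} zopt2" for T
    by (rule ac_primitive_continuous[OF ac_primitive_on_subset[OF ac2]]) auto
  have ac1: "ac_primitive_on {0..} zopt1 zopt2"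
    by (intro ac_primitive_on_atLeast ac_primitive_onI c2) (simp add: zopt1_def)
  have c1: "continuous_on {0..T} zopt1" for T
    by (rule ac_primitive_continuous[OF ac_primitive_on_subset[OF ac1]]) auto
  have "ac_primitive_on {0..} zopt zopt1"
    by (intro ac_primitive_on_atLeast ac_primitive_onI c1) (simp add: zopt_def)
  then show ?thesis
    using ac1 ac2 by (simp add: triple_integrator_def)
qed

lemma bang_cells_final_state:
  assumes ti: "triple_integrator {0..T} z z1 z2 v" and init: "z 0 = 0" "z1 0 = 0" "z2 0 = 1"
    and T: "\<tau>inf \<le> T" and bang: "\<And>i. bang_cell (tau i) (len i) v"
  shows "z \<tau>inf = 0" "z1 \<tau>inf = 0" "z2 \<tau>inf = 0"
proof -
  have tT: "tau i \<le> T" for i using tau_less[of i] T by simp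
  have st: "z (tau i) = 0" "z1 (tau i) = 0" "z2 (tau i) = \<alpha> ^ i" for i
    using bang_cells_state[OF ti init tT bang] by auto
  have lim: "(\<lambda>N. f (tau N)) \<longlonglongrightarrow> f \<tau>inf" if "continuous_on {0..T} f" for f :: "real \<Rightarrow> real"
    by (rule continuous_on_tendsto_compose[OF that tendsto_tau])
      (use \<tau>inf_pos T tau_nonneg tT in auto)
  note cont = triple_integrator_continuous[OF ti]
  show "z \<tau>inf = 0" "z1 \<tau>inf = 0" "z2 \<tau>inf = 0"
    using LIMSEQ_unique[OF lim[OF cont(1)], of 0] LIMSEQ_unique[OF lim[OF cont(2)], of 0]
      LIMSEQ_unique[OF lim[OF cont(3)], of 0] tendsto_power_\<alpha>
    by (simp_all add: st)
qed

lemma bang_cells_nonneg: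
  assumes ti: "triple_integrator {0..T} z z1 z2 v" and init: "z 0 = 0" "z1 0 = 0" "z2 0 = 1"
    and T: "\<tau>inf \<le> T" and bang: "\<And>i. bang_cell (tau i) (len i) v"
    and t: "0 \<le> t" "t < \<tau>inf"
  shows "0 \<le> z t" "z t = 0 \<longleftrightarrow> t \<in> range tau"
proof -
  have tT: "tau i \<le> T" for i using tau_less[of i] T by simp
  have st: "z (tau i) = 0" for i
    using bang_cells_state[OF ti init tT bang] by auto
  obtain i where i: "tau i \<le> t" "t < tau (Suc i)"
    using tau_cover[OF t] .
  have "0 < z t" if "tau i < t"
    by (rule bang_cells_pos[OF ti init tT bang that i(2)])
  moreover have "t \<notin> range tau" if "tau i < t"
  proof
    assume "t \<in> range tau"
    then obtain j where "t = tau j" by auto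
    then have "i < j" "j < Suc i"
      using that i(2) strict_mono_less[OF strict_mono_tau] by auto
    then show False by simp
  qed
  ultimately show "0 \<le> z t" "z t = 0 \<longleftrightarrow> t \<in> range tau"
    using i(1) st by (cases "tau i = t"; force)+
qed

lemma zopt_init: "zopt 0 = 0" "zopt1 0 = 0" "zopt2 0 = 1"
  by (simp_all add: zopt_def zopt1_def zopt2_def)

lemma triple_integrator_zopt_on: "triple_integrator {0..T} zopt zopt1 zopt2 vopt"
  by (rule triple_integrator_subset[OF triple_integrator_zopt]) auto

lemma zopt_after:
  assumes "\<tau>inf \<le> t"
  shows "zopt t = 0" "zopt1 t = 0" "zopt2 t = 0"
proof -
  have "AE s in lebesgue. \<tau>inf < s \<and> s < t \<longrightarrow> vopt s = 0"
    using vopt_after by (intro AE_I2) auto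
  note * = triple_integrator_const[OF triple_integrator_zopt_on less_imp_le[OF \<tau>inf_pos] order_refl this assms order_refl]
  note ** = bang_cells_final_state[OF triple_integrator_zopt_on zopt_init order_refl bang_cell_vopt]
  show "zopt t = 0" "zopt1 t = 0" "zopt2 t = 0"
    using * ** by simp_all
qed

lemma zopt_nonneg: "0 \<le> t \<Longrightarrow> 0 \<le> zopt t"
  using bang_cells_nonneg(1)[OF triple_integrator_zopt_on zopt_init order_refl bang_cell_vopt, of t] zopt_after[of t]
  by (cases "t < \<tau>inf") auto

lemma integral_zopt: "integral {0..\<tau>inf} zopt = Jopt"
  by (rule bang_cells_total_cost[OF triple_integrator_zopt_on zopt_init abs_vopt_le order_refl bang_cell_vopt])

lemma has_integral_zopt:
  assumes "\<tau>inf \<le> T"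
  shows "(zopt has_integral Jopt) {0..T}" "(zopt has_integral Jopt) {0..}"
proof -
  have "zopt integrable_on {0..\<tau>inf}"
    by (rule integrable_continuous_real[OF triple_integrator_continuous(1)[OF triple_integrator_zopt_on]])
  then have I: "(zopt has_integral Jopt) {0..\<tau>inf}"
    using integral_zopt by (metis integrable_integral)
  \<comment> \<open>For negative \<open>t\<close> the interval \<open>{0..t}\<close> is empty, so
    the integral defining \<open>zopt\<close> is 0 there.\<close>
  have "zopt t = 0" if "t \<notin> {0..\<tau>inf}" for t
    using that zopt_after[of t] by (cases "t < 0") (auto simp: zopt_def)
  then show "(zopt has_integral Jopt) {0..T}" "(zopt has_integral Jopt) {0..}"
    using assms by (auto intro!: has_integral_on_superset[OF I])
qed

lemma cost_ge_Jopt: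
  assumes ti: "triple_integrator {0..} z z1 z2 v" and init: "z 0 = 0" "z1 0 = 0" "z2 0 = 1"
    and v: "\<And>t. 0 \<le> t \<Longrightarrow> \<bar>v t\<bar> \<le> 1" and z: "\<And>t. 0 \<le> t \<Longrightarrow> 0 \<le> z t"
  shows "Jopt \<le> integral {0..\<tau>inf} z"
proof -
  have ti': "triple_integrator {0..\<tau>inf} z z1 z2 v"
    by (rule triple_integrator_subset[OF ti]) auto
  have "0 \<le> defect (tau 0) (len 0) v"
    using tau_less[of 1] v len_pos[of 0]
    by (intro defect_nonneg[OF ti']) (auto simp: tau_Suc)
  moreover have "Jopt + defect (tau 0) (len 0) v / 6 \<le> integral {0..\<tau>inf} z"
    by (rule cost_lower_bound[OF ti' init]) (use v z in auto)
  ultimately show ?thesis by simp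
qed

lemma R_opt_value_eq: "R_opt_value = Jopt"
  unfolding R_opt_value_def
proof (rule cInf_eq_minimum)
  define y :: "real \<Rightarrow> real ^ 3" where "y t = vector [zopt2 t, zopt1 t, zopt t]" for t
  have "R_feasible y vopt"
    using triple_integrator_zopt zopt_init zopt_nonneg abs_vopt_le
    by (simp add: R_feasible_def y_def triple_integrator_def)
  moreover have "((\<lambda>\<tau>. y \<tau> $ 3) has_integral Jopt) {0..}"
    using has_integral_zopt(2)[OF order_refl] by (simp add: y_def)
  ultimately show "Jopt \<in> {J. \<exists>y v. R_feasible y v \<and> ((\<lambda>\<tau>. y \<tau> $ 3) has_integral J) {0..}}"
    by blast
next
  fix J assume "J \<in> {J. \<exists>y v. R_feasible y v \<and> ((\<lambda>\<tau>. y \<tau> $ 3) has_integral J) {0..}}"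
  then obtain y v where R: "R_feasible y v" and J: "((\<lambda>\<tau>. y \<tau> $ 3) has_integral J) {0..}"
    by blast
  have y0: "y 0 $ 3 = 0" "y 0 $ 2 = 0" "y 0 $ 1 = 1"
    using R by (auto simp: R_feasible_def)
  have y: "0 \<le> y t $ 3" if "0 \<le> t" for t
    using R y0 that by (cases "t = 0") (auto simp: R_feasible_def)
  \<comment> \<open>Feasibility bounds \<open>v\<close> only at positive times. Changing its value
    at 0 keeps all integrals and gives the bound on the closed half-line.\<close>
  define w where "w t = (if t = 0 then 0 else v t)" for t :: real
  have "ac_primitive_on {0..} (\<lambda>\<tau>. y \<tau> $ 1) w"
    unfolding ac_primitive_on_def
  proof (intro ballI conjI)
    fix t :: real assume t: "t \<in> {0..}"
    have ac: "ac_primitive_on {0..} (\<lambda>\<tau>. y \<tau> $ 1) v"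
      using R by (simp add: R_feasible_def)
    show "w absolutely_integrable_on {0..t}"
      using absolutely_integrable_spike[OF ac_primitive_onD(2)[OF ac t], of "{0}" w] by (simp add: w_def)
    show "y t $ 1 = y 0 $ 1 + integral {0..t} w"
      unfolding ac_primitive_onD(1)[OF ac t, symmetric]
      using integral_spike[of "{0}" "{0..t}" w v] by (simp add: w_def)
  qed
  then have "triple_integrator {0..} (\<lambda>\<tau>. y \<tau> $ 3) (\<lambda>\<tau>. y \<tau> $ 2) (\<lambda>\<tau>. y \<tau> $ 1) w"
    using R by (simp add: R_feasible_def triple_integrator_def)
  moreover have "\<bar>w t\<bar> \<le> 1" if "0 \<le> t" for t
    using R that by (simp add: R_feasible_def w_def)
  ultimately have "Jopt \<le> integral {0..\<tau>inf} (\<lambda>\<tau>. y \<tau> $ 3)"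
    using y0 y by (intro cost_ge_Jopt[of _ "\<lambda>\<tau>. y \<tau> $ 2" "\<lambda>\<tau>. y \<tau> $ 1" w])
  \<comment> \<open>The dual bound covers only the time up to \<open>\<tau>inf\<close>; the rest of
    the cost is nonnegative.\<close>
  also have "\<dots> \<le> integral {0..} (\<lambda>\<tau>. y \<tau> $ 3)"
  proof (rule integral_subset_le)
    show "(\<lambda>\<tau>. y \<tau> $ 3) integrable_on {0..}"
      using J by (rule has_integral_integrable)
    show "(\<lambda>\<tau>. y \<tau> $ 3) integrable_on {0..\<tau>inf}"
      by (rule integrable_on_subinterval[OF has_integral_integrable[OF J]]) auto
  qed (use y in auto)
  also have "\<dots> = J"
    using J by (rule integral_unique)
  finally show "Jopt \<le> J" .
qed

text \<open>\<open>T\<close> may be smaller than \<open>\<tau>inf\<close>, where the certificate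
  lives. Since the trajectory ends at rest, it can be prolonged by 0 at no cost.\<close>

lemma finite_horizon_cost:
  assumes ti: "triple_integrator {0..T} z z1 z2 v" and init: "z 0 = 0" "z1 0 = 0" "z2 0 = 1"
    and T: "0 \<le> T" and final: "z T = 0" "z1 T = 0" "z2 T = 0"
    and v: "\<And>t. t \<in> {0..T} \<Longrightarrow> \<bar>v t\<bar> \<le> 1" and z: "\<And>t. t \<in> {0..T} \<Longrightarrow> 0 \<le> z t"
  shows "Jopt \<le> integral {0..T} z"
proof -
  define e where "e f t = (if t \<in> {0..T} then f t else 0)" for f :: "real \<Rightarrow> real" and t
  have "triple_integrator {0..} (e z) (e z1) (e z2) (e v)"
    using ti ac_primitive_on_extend_zero[OF _ T] final unfolding triple_integrator_def e_def by blast
  then have "Jopt \<le> integral {0..\<tau>inf} (e z)"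
    using T init v z by (intro cost_ge_Jopt[of "e z" "e z1" "e z2" "e v"]) (auto simp: e_def)
  also have "\<dots> \<le> integral {0..T} z"
  proof -
    have zc: "continuous_on {0..T} z" by (rule triple_integrator_continuous[OF ti])
    have ez: "(e z has_integral integral {0..T} z) {0..max T \<tau>inf}"
      unfolding e_def using has_integral_restrict[of "{0..T}" "{0..max T \<tau>inf}" z]
        integrable_continuous_real[OF zc] by (metis atLeastatMost_subset_iff integrable_integral max.cobounded1 order_refl)
    have "integral {0..\<tau>inf} (e z) \<le> integral {0..max T \<tau>inf} (e z)"
    proof (rule integral_subset_le)
      show "e z integrable_on {0..\<tau>inf}"
        by (rule integrable_on_subinterval[OF has_integral_integrable[OF ez]]) auto
    qed (use z has_integral_integrable[OF ez] in \<open>auto simp: e_def\<close>)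
    then show ?thesis using integral_unique[OF ez] by simp
  qed
  finally show ?thesis .
qed

text \<open>As \<open>z\<close> is nonnegative, its cost up to \<open>\<tau>inf\<close> is at most
  \<open>Jopt\<close>, which forces the bang cells and makes that cost equal to \<open>Jopt\<close>.
  Nothing is left for the interval after \<open>\<tau>inf\<close>, so the continuous function
  \<open>z\<close> vanishes there, and with it the control almost everywhere.\<close>

lemma finite_horizon_optimal:
  assumes ti: "triple_integrator {0..T} z z1 z2 v" and init: "z 0 = 0" "z1 0 = 0" "z2 0 = 1"
    and T: "\<tau>inf \<le> T"
    and v: "\<And>t. t \<in> {0..T} \<Longrightarrow> \<bar>v t\<bar> \<le> 1" and z: "\<And>t. t \<in> {0..T} \<Longrightarrow> 0 \<le> z t"
    and opt: "integral {0..T} z = Jopt"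
  shows "bang_cell (tau i) (len i) v" "\<And>t. t \<in> {\<tau>inf..T} \<Longrightarrow> z t = 0"
    "AE t in lebesgue. t \<in> {\<tau>inf<..<T} \<longrightarrow> v t = 0"
proof -
  have cz: "continuous_on {0..T} z"
    by (rule triple_integrator_continuous[OF ti])
  have zi: "z integrable_on {0..T}"
    by (rule integrable_continuous_real[OF cz])
  have split: "integral {0..\<tau>inf} z + integral {\<tau>inf..T} z = Jopt"
    using Henstock_Kurzweil_Integration.integral_combine[OF less_imp_le[OF \<tau>inf_pos] T zi] opt by simp
  have zi2: "z integrable_on {\<tau>inf..T}"
    by (rule integrable_subinterval_real[OF zi]) (use \<tau>inf_pos in auto)
  have nn: "0 \<le> integral {\<tau>inf..T} z"
    by (rule integral_nonneg[OF zi2]) (use z \<tau>inf_pos in auto)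
  show bang: "bang_cell (tau i) (len i) v" for i
    by (rule optimal_imp_bang_cell[OF ti init v z T]) (use split nn in auto)
  have "integral {0..\<tau>inf} z = Jopt"
    by (rule bang_cells_total_cost[OF ti init v T bang])
  then have 0: "integral {\<tau>inf..T} z = 0" using split by simp
  show after: "z t = 0" if t: "t \<in> {\<tau>inf..T}" for t
  proof (cases "\<tau>inf < T")
    case True
    show ?thesis
    proof (rule has_integral_0_cbox_imp_0[of \<tau>inf T z])
      show "continuous_on (cbox \<tau>inf T) z"
        by (rule continuous_on_subset[OF cz]) (use \<tau>inf_pos in auto)
      show "(z has_integral 0) (cbox \<tau>inf T)"
        using zi2 0 by (metis box_real(2) integrable_integral)
    qed (use z t True \<tau>inf_pos in auto)
  next
    case False
    then show ?thesis using t T bang_cells_final_state(1)[OF ti init T bang] by simp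
  qed
  show "AE t in lebesgue. t \<in> {\<tau>inf<..<T} \<longrightarrow> v t = 0"
    by (rule triple_integrator_0_imp_AE_0[OF ti less_imp_le[OF \<tau>inf_pos] after])
qed

end

section \<open>Problem (Q)\<close>

lemma vector_4:
  "(vector [a, b, c, d] :: 'a::zero ^ 4) $ 1 = a"
  "(vector [a, b, c, d] :: 'a::zero ^ 4) $ 2 = b"
  "(vector [a, b, c, d] :: 'a::zero ^ 4) $ 3 = c"
  "(vector [a, b, c, d] :: 'a::zero ^ 4) $ 4 = d"
  unfolding vector_def by simp_all

lemma AE_lebesgue_affine:
  fixes a c :: real
  assumes P: "AE t in lebesgue. P t" and c: "c \<noteq> 0"
  shows "AE t in lebesgue. P (a + c * t)"
proof -
  obtain N where N: "negligible N" "{t. \<not> P t} \<subseteq> N"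
    using P unfolding eventually_ae_filter_negligible by blast
  have "negligible ((\<lambda>s. s / c) ` (\<lambda>s. - a + s) ` N)"
    by (intro negligible_differentiable_image_negligible negligible_translation N(1))
      (auto intro!: differentiable_at_imp_differentiable_on derivative_intros simp: c)
  moreover have "{t. \<not> P (a + c * t)} \<subseteq> (\<lambda>s. s / c) ` (\<lambda>s. - a + s) ` N"
  proof
    fix t assume "t \<in> {t. \<not> P (a + c * t)}"
    then have "a + c * t \<in> N" using N(2) by auto
    moreover have "t = (- a + (a + c * t)) / c" using c by simp
    ultimately show "t \<in> (\<lambda>s. s / c) ` (\<lambda>s. - a + s) ` N" by blast
  qed
  ultimately show ?thesis
    unfolding eventually_ae_filter_negligible by blast
qed

lemma ac_primitive_on_rescaleI:
  assumes "ac_primitive_on {0..T} x f" "0 < \<sigma>" "T' = T / \<sigma>"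
    and "\<And>t. y t = c * x (\<sigma> * t)" "\<And>t. g t = c * \<sigma> * f (\<sigma> * t)"
  shows "ac_primitive_on {0..T'} y g"
proof -
  have "y = (\<lambda>t. c * x (\<sigma> * t))" "g = (\<lambda>t. c * \<sigma> * f (\<sigma> * t))"
    using assms(4,5) by auto
  then show ?thesis
    using ac_primitive_on_rescale[OF assms(1,2)] assms(3) by simp
qed

lemma has_integral_affine_rescale:
  fixes z :: "real \<Rightarrow> real"
  assumes "(z has_integral I) {0..t / \<sigma>}" "0 < \<sigma>" "0 \<le> t"
  shows "((\<lambda>s. M + c * z (s / \<sigma>)) has_integral (M * t + c * \<sigma> * I)) {0..t}"
proof -
  have "((\<lambda>s. z (s / \<sigma>)) has_integral (\<sigma> * I)) {0..t}"
    using has_integral_affinity'[of z I 0 "t / \<sigma>" "1 / \<sigma>" 0] assms by (simp add: field_simps)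
  from has_integral_mult_right[OF this, of c]
  have "((\<lambda>s. c * z (s / \<sigma>)) has_integral (c * \<sigma> * I)) {0..t}"
    by (simp add: mult.assoc)
  moreover have "((\<lambda>_. M) has_integral (M * t)) {0..t}"
    using has_integral_const_real[of M 0 t] assms(3) by (simp add: mult.commute)
  ultimately show ?thesis
    by (rule has_integral_add[rotated])
qed

text \<open>\<open>\<sigma>\<close> is the time unit in which the control bound and the initial
  value of \<open>z2\<close> both become 1. Dividing by the negative \<open>x01\<close> turns the
  upper bound \<open>M3\<close> on the third component into \<open>0 \<le> z\<close> and reverses
  the control. The factor in the last claim is \<open>x01^4 / M0^3 = - x01 * \<sigma>^3\<close>. The
  rescaled functions enter through equations so that a caller can supply its own local
  definitions.\<close>

lemma Q_feasible_rescaled: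
  assumes M0: "0 < M0" and x01: "x01 < 0" and Q: "Q_feasible M0 M3 x01 x04 xf4 x u tf"
    and \<sigma>_def: "\<sigma> = - (x01 / M0)"
    and z_def: "z = (\<lambda>s. (x (\<sigma> * s) $ 3 - M3) / (x01 * \<sigma>^2))"
    and z1_def: "z1 = (\<lambda>s. x (\<sigma> * s) $ 2 / (x01 * \<sigma>))"
    and z2_def: "z2 = (\<lambda>s. x (\<sigma> * s) $ 1 / x01)"
    and v_def: "v = (\<lambda>s. - u (\<sigma> * s) / M0)"
  shows "triple_integrator {0..tf / \<sigma>} z z1 z2 v"
    and "z 0 = 0" "z1 0 = 0" "z2 0 = 1"
    and "z (tf / \<sigma>) = 0" "z1 (tf / \<sigma>) = 0" "z2 (tf / \<sigma>) = 0"
    and "\<And>s. s \<in> {0..tf / \<sigma>} \<Longrightarrow> \<bar>v s\<bar> \<le> 1"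
    and "\<And>s. s \<in> {0..tf / \<sigma>} \<Longrightarrow> 0 \<le> z s"
    and "\<And>t. t \<in> {0..tf} \<Longrightarrow> x t $ 4 = x04 + M3 * t - x01^4 / M0^3 * integral {0..t / \<sigma>} z"
proof -
  have \<sigma>: "0 < \<sigma>" using M0 x01 by (simp add: \<sigma>_def divide_neg_pos)
  have x01': "x01 \<noteq> 0" "x01 = - (\<sigma> * M0)" using M0 x01 by (auto simp: \<sigma>_def)
  have tf: "0 \<le> tf" and
    ac: "ac_primitive_on {0..tf} (\<lambda>t. x t $ 4) (\<lambda>t. x t $ 3)"
     "ac_primitive_on {0..tf} (\<lambda>t. x t $ 3) (\<lambda>t. x t $ 2)"
     "ac_primitive_on {0..tf} (\<lambda>t. x t $ 2) (\<lambda>t. x t $ 1)"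
     "ac_primitive_on {0..tf} (\<lambda>t. x t $ 1) u" and
    x0: "x 0 = vector [x01, 0, M3, x04]" and xf: "x tf = vector [0, 0, M3, xf4]" and
    con: "\<And>t. t \<in> {0..tf} \<Longrightarrow> x t $ 3 \<le> M3" "\<And>t. t \<in> {0..tf} \<Longrightarrow> \<bar>u t\<bar> \<le> M0"
    using Q by (auto simp: Q_feasible_def)
  have ac3: "ac_primitive_on {0..tf} (\<lambda>t. - M3 + x t $ 3) (\<lambda>t. x t $ 2)"
    by (rule ac_primitive_on_add_const[OF ac(2)])
  have z: "ac_primitive_on {0..tf / \<sigma>} z z1"
    by (rule ac_primitive_on_rescaleI[OF ac3 \<sigma> refl, of _ "1 / (x01 * \<sigma>^2)"])
      (use \<sigma> x01'(1) in \<open>auto simp: z_def z1_def power2_eq_square\<close>)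
  have z1: "ac_primitive_on {0..tf / \<sigma>} z1 z2"
    by (rule ac_primitive_on_rescaleI[OF ac(3) \<sigma> refl, of _ "1 / (x01 * \<sigma>)"])
      (use \<sigma> x01'(1) in \<open>auto simp: z1_def z2_def\<close>)
  have z2: "ac_primitive_on {0..tf / \<sigma>} z2 v"
    by (rule ac_primitive_on_rescaleI[OF ac(4) \<sigma> refl, of _ "1 / x01"])
      (use \<sigma> M0 in \<open>auto simp: z2_def v_def x01'(2)\<close>)
  show "triple_integrator {0..tf / \<sigma>} z z1 z2 v"
    using z z1 z2 by (simp add: triple_integrator_def)
  show "z 0 = 0" "z1 0 = 0" "z2 0 = 1"
    using x01'(1) by (simp_all add: z_def z1_def z2_def x0 vector_4)
  show "z (tf / \<sigma>) = 0" "z1 (tf / \<sigma>) = 0" "z2 (tf / \<sigma>) = 0"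
    using \<sigma> by (simp_all add: z_def z1_def z2_def xf vector_4)
  have dom: "\<sigma> * s \<in> {0..tf}" if "s \<in> {0..tf / \<sigma>}" for s
    using that \<sigma> by (auto simp: field_simps)
  show "\<bar>v s\<bar> \<le> 1" if "s \<in> {0..tf / \<sigma>}" for s
    using con(2)[OF dom[OF that]] M0 by (simp add: v_def abs_divide)
  show "0 \<le> z s" if "s \<in> {0..tf / \<sigma>}" for s
    unfolding z_def using con(1)[OF dom[OF that]] x01 \<sigma>
    by (intro divide_nonpos_neg) (auto intro: mult_neg_pos)
  show "x t $ 4 = x04 + M3 * t - x01^4 / M0^3 * integral {0..t / \<sigma>} z" if t: "t \<in> {0..tf}" for t
  proof -
    have "t / \<sigma> \<le> tf / \<sigma>" using t \<sigma> by (simp add: divide_right_mono)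
    then have "z integrable_on {0..t / \<sigma>}"
      by (intro integrable_continuous_real continuous_on_subset[OF ac_primitive_continuous[OF z]]) auto
    from has_integral_affine_rescale[OF integrable_integral[OF this] \<sigma>, of M3 "x01 * \<sigma>^2"]
    have "((\<lambda>s. M3 + x01 * \<sigma>^2 * z (s / \<sigma>)) has_integral
       (M3 * t + x01 * \<sigma>^2 * \<sigma> * integral {0..t / \<sigma>} z)) {0..t}"
      using t by simp
    moreover have "M3 + x01 * \<sigma>^2 * z (s / \<sigma>) = x s $ 3" for s
      using x01'(1) \<sigma> by (simp add: z_def)
    moreover have "x01 * \<sigma>^2 * \<sigma> = - (x01^4 / M0^3)"
      using M0 by (simp add: \<sigma>_def field_simps eval_nat_numeral)
    ultimately have "integral {0..t} (\<lambda>t. x t $ 3) = M3 * t - x01^4 / M0^3 * integral {0..t / \<sigma>} z"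
      by (simp add: integral_unique)
    then show ?thesis
      using ac_primitive_onD(1)[OF ac(1) t] by (simp add: x0 vector_4)
  qed
qed

section \<open>The minimal time of (Q) and its extremal controls\<close>

context chattering_system
begin

lemma Q_feasible_cost:
  assumes M0: "0 < M0" and M3: "0 < M3" and x01: "x01 < 0" and Q: "Q_feasible M0 M3 x01 x04 xf4 x u tf"
  shows "(xf4 - x04) / M3 + x01^4 * R_opt_value / (M0^3 * M3) \<le> tf"
proof -
  define \<sigma> where "\<sigma> = - (x01 / M0)"
  have \<sigma>: "0 < \<sigma>" using M0 x01 by (simp add: \<sigma>_def divide_neg_pos)
  define z z1 z2 v where "z = (\<lambda>s. (x (\<sigma> * s) $ 3 - M3) / (x01 * \<sigma>^2))"
    and "z1 = (\<lambda>s. x (\<sigma> * s) $ 2 / (x01 * \<sigma>))" and "z2 = (\<lambda>s. x (\<sigma> * s) $ 1 / x01)"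
    and "v = (\<lambda>s. - u (\<sigma> * s) / M0)"
  have tf: "0 \<le> tf" "x tf $ 4 = xf4"
    using Q by (auto simp: Q_feasible_def vector_4)
  note r = Q_feasible_rescaled[OF M0 x01 Q \<sigma>_def z_def z1_def z2_def v_def]
  have "Jopt \<le> integral {0..tf / \<sigma>} z"
    by (rule finite_horizon_cost[OF r(1-4) divide_nonneg_pos[OF tf(1) \<sigma>] r(5-9)])
  then have "x01^4 / M0^3 * Jopt \<le> x01^4 / M0^3 * integral {0..tf / \<sigma>} z"
    using M0 by (intro mult_left_mono) auto
  then have "(xf4 - x04) + x01^4 / M0^3 * Jopt \<le> tf * M3"
    using r(10)[of tf] tf by (simp add: mult.commute)
  then have "((xf4 - x04) + x01^4 / M0^3 * Jopt) / M3 \<le> tf"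
    using M3 by (simp add: divide_le_eq)
  then show ?thesis
    by (simp add: R_opt_value_eq add_divide_distrib)
qed

text \<open>\<open>tf\<close> is the time at which the fourth component, whose average speed is
  reduced by the cost \<open>Jopt\<close>, arrives at \<open>xf4\<close>. The assumption on
  \<open>tf\<close> leaves room for the whole chattering arc; afterwards the state coasts with third
  component \<open>M3\<close>.\<close>

lemma Q_chattering_feasible:
  fixes M0 M3 x01 x04 xf4 :: real
  assumes M0: "0 < M0" and M3: "0 < M3" and x01: "x01 < 0"
  defines "\<sigma> \<equiv> - (x01 / M0)" and "tf \<equiv> (xf4 - x04) / M3 + x01^4 * R_opt_value / (M0^3 * M3)"
  assumes tf: "\<sigma> * \<tau>inf \<le> tf"
  obtains x where "Q_feasible M0 M3 x01 x04 xf4 x (\<lambda>t. - M0 * vopt (t / \<sigma>)) tf"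
proof
  have \<sigma>: "0 < \<sigma>" using M0 x01 by (simp add: \<sigma>_def divide_neg_pos)
  define x3 where "x3 t = M3 + x01 * \<sigma>^2 * zopt (t / \<sigma>)" for t
  define x :: "real \<Rightarrow> real ^ 4" where
    "x t = vector [x01 * zopt2 (t / \<sigma>), x01 * \<sigma> * zopt1 (t / \<sigma>), x3 t, x04 + integral {0..t} x3]" for t
  have ac: "ac_primitive_on {0..tf / \<sigma>} zopt zopt1" "ac_primitive_on {0..tf / \<sigma>} zopt1 zopt2"
    "ac_primitive_on {0..tf / \<sigma>} zopt2 vopt"
    using triple_integrator_zopt_on by (auto simp: triple_integrator_def)
  \<comment> \<open>The passage back from (R) is a rescaling by \<open>1 / \<sigma>\<close>, which
    takes the horizon \<open>tf / \<sigma>\<close> to \<open>tf\<close>.\<close>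
  have \<sigma>': "0 < 1 / \<sigma>" "tf = tf / \<sigma> / (1 / \<sigma>)" using \<sigma> by auto
  have a3: "ac_primitive_on {0..tf} x3 (\<lambda>t. x01 * \<sigma> * zopt1 (t / \<sigma>))"
    unfolding x3_def[abs_def]
    by (rule ac_primitive_on_add_const[OF ac_primitive_on_rescaleI[OF ac(1) \<sigma>', of _ "x01 * \<sigma>^2"]])
      (use \<sigma> in \<open>auto simp: power2_eq_square\<close>)
  have a2: "ac_primitive_on {0..tf} (\<lambda>t. x01 * \<sigma> * zopt1 (t / \<sigma>)) (\<lambda>t. x01 * zopt2 (t / \<sigma>))"
    by (rule ac_primitive_on_rescaleI[OF ac(2) \<sigma>', of _ "x01 * \<sigma>"]) (use \<sigma> in auto)
  have x01\<sigma>: "x01 / \<sigma> = - M0" using M0 x01 by (simp add: \<sigma>_def)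
  have a1: "ac_primitive_on {0..tf} (\<lambda>t. x01 * zopt2 (t / \<sigma>)) (\<lambda>t. - M0 * vopt (t / \<sigma>))"
    by (rule ac_primitive_on_rescaleI[OF ac(3) \<sigma>', of _ x01]) (use M0 x01 in \<open>auto simp: \<sigma>_def[symmetric] x01\<sigma>\<close>)
  have a4: "ac_primitive_on {0..tf} (\<lambda>t. x04 + integral {0..t} x3) x3"
    by (rule ac_primitive_onI[OF ac_primitive_continuous[OF a3]]) simp
  have tf0: "0 \<le> tf" "\<tau>inf \<le> tf / \<sigma>"
    using tf \<sigma> \<tau>inf_pos by (auto simp: field_simps intro: order_trans[OF _ tf])
  have "(x3 has_integral (M3 * tf + x01 * \<sigma>^2 * \<sigma> * Jopt)) {0..tf}"
    unfolding x3_def[abs_def]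
    by (rule has_integral_affine_rescale[OF has_integral_zopt(1)[OF tf0(2)] \<sigma> tf0(1)])
  moreover have "x01 * \<sigma>^2 * \<sigma> = - (x01^4 / M0^3)"
    using M0 by (simp add: \<sigma>_def field_simps eval_nat_numeral)
  ultimately have "integral {0..tf} x3 = M3 * tf - x01^4 / M0^3 * Jopt"
    by (simp add: integral_unique)
  moreover have "M3 * tf = xf4 - x04 + x01^4 / M0^3 * Jopt"
    using M3 by (simp add: tf_def R_opt_value_eq field_simps)
  ultimately have i4: "x04 + integral {0..tf} x3 = xf4" by simp
  have x3f: "x3 tf = M3" "x3 0 = M3"
    using zopt_after[OF tf0(2)] zopt_init by (simp_all add: x3_def)
  have "x3 t \<le> M3" if "t \<in> {0..tf}" for t
    using that \<sigma> x01 zopt_nonneg[of "t / \<sigma>"]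
    by (auto simp: x3_def intro!: mult_nonpos_nonneg mult_nonneg_nonneg)
  moreover have "\<bar>- M0 * vopt (t / \<sigma>)\<bar> \<le> M0" for t
    using M0 abs_vopt_le[of "t / \<sigma>"] by (simp add: abs_mult)
  moreover have "x tf = vector [0, 0, M3, xf4]"
    unfolding x_def x3f i4 using zopt_after[OF tf0(2)] by simp
  moreover have "x 0 = vector [x01, 0, M3, x04]"
    unfolding x_def x3f using zopt_init by simp
  ultimately show "Q_feasible M0 M3 x01 x04 xf4 x (\<lambda>t. - M0 * vopt (t / \<sigma>)) tf"
    unfolding Q_feasible_def using tf0 a1 a2 a3 a4 by (simp add: x_def vector_4)
qed


lemma cell_affine: "(1 - \<beta>) * (c * tau i) + \<beta> * (c * tau (Suc i)) = c * (tau i + \<beta> * len i)"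
  by (simp add: tau_Suc algebra_simps)

lemma bang_cell_rescaled:
  assumes \<sigma>: "0 < \<sigma>" and v: "bang_cell (tau i) (len i) (\<lambda>s. - u (\<sigma> * s) / M)" and M: "0 < M"
  shows "AE s in lebesgue.
    (\<sigma> * tau i < s \<and> s < \<sigma> * (tau i + \<beta>1 * len i) \<longrightarrow> u s = M) \<and>
    (\<sigma> * (tau i + \<beta>1 * len i) < s \<and> s < \<sigma> * (tau i + \<beta>2 * len i) \<longrightarrow> u s = - M) \<and>
    (\<sigma> * (tau i + \<beta>2 * len i) < s \<and> s < \<sigma> * (tau i + len i) \<longrightarrow> u s = M)"
proof -
  have "1 / \<sigma> \<noteq> 0" using \<sigma> by simp
  from AE_lebesgue_affine[OF v[unfolded bang_cell_def] this, of 0]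
  show ?thesis
  proof eventually_elim
    case (elim s)
    have sc: "a < 0 + 1 / \<sigma> * s \<longleftrightarrow> \<sigma> * a < s" "0 + 1 / \<sigma> * s < a \<longleftrightarrow> s < \<sigma> * a" for a
      using \<sigma> by (auto simp: field_simps)
    have u: "- u (\<sigma> * (0 + 1 / \<sigma> * s)) / M = -1 \<longleftrightarrow> u s = M" "- u (\<sigma> * (0 + 1 / \<sigma> * s)) / M = 1 \<longleftrightarrow> u s = - M"
      using \<sigma> M by (auto simp: field_simps)
    show ?case
      using elim unfolding sc u .
  qed
qed

lemma bang_cell_control:
  assumes \<sigma>: "0 < \<sigma>" and v: "bang_cell (tau i) (len i) (\<lambda>s. - u (\<sigma> * s) / M)" and M: "0 < M"
  shows "AE \<beta> in lebesgue.
    (\<beta> \<in> {0<..<\<beta>1} \<longrightarrow> u (\<sigma> * (tau i + \<beta> * len i)) = M) \<and>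
    (\<beta> \<in> {\<beta>1<..<\<beta>2} \<longrightarrow> u (\<sigma> * (tau i + \<beta> * len i)) = - M) \<and>
    (\<beta> \<in> {\<beta>2<..<1} \<longrightarrow> u (\<sigma> * (tau i + \<beta> * len i)) = M)"
proof -
  have "len i \<noteq> 0" using len_pos[of i] by simp
  from AE_lebesgue_affine[OF v[unfolded bang_cell_def] this, of "tau i"]
  show ?thesis
  proof eventually_elim
    case (elim \<beta>)
    have sc: "tau i + b * len i < tau i + len i * \<beta> \<longleftrightarrow> b < \<beta>" "tau i + len i * \<beta> < tau i + b * len i \<longleftrightarrow> \<beta> < b" for b
      using len_pos[of i] by (auto simp: mult.commute)
    have sc': "tau i < tau i + len i * \<beta> \<longleftrightarrow> 0 < \<beta>" "tau i + len i * \<beta> < tau i + len i \<longleftrightarrow> \<beta> < 1"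
      using sc[of 0] sc[of 1] by simp_all
    have u: "- u (\<sigma> * (tau i + len i * \<beta>)) / M = -1 \<longleftrightarrow> u (\<sigma> * (tau i + \<beta> * len i)) = M"
        "- u (\<sigma> * (tau i + len i * \<beta>)) / M = 1 \<longleftrightarrow> u (\<sigma> * (tau i + \<beta> * len i)) = - M"
      using M by (auto simp: field_simps)
    show ?case
      using elim unfolding sc sc' u by simp
  qed
qed

text \<open>One switch per cell suffices, namely the one at \<beta>1. These times lie below
  \<open>\<sigma> * \<tau>inf\<close> and converge to it, so it is a limit point of the switching
  times, and a set with a limit point is infinite.\<close>

lemma bang_cells_chattering:
  assumes \<sigma>: "0 < \<sigma>" and v: "\<And>i. bang_cell (tau i) (len i) (\<lambda>s. - u (\<sigma> * s) / M)" and M: "0 < M"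
  shows "chattering u (\<sigma> * \<tau>inf)"
proof -
  define s where "s i = \<sigma> * (tau i + \<beta>1 * len i)" for i
  define S where "S = {t \<in> {0<..<\<sigma> * \<tau>inf}. switching_time u t}"
  have less: "\<sigma> * tau i < s i" "s i < \<sigma> * (tau i + \<beta>2 * len i)" "s i < \<sigma> * \<tau>inf" "0 < s i" for i
  proof -
    have "tau i < tau i + \<beta>1 * len i" "tau i + \<beta>1 * len i < tau i + \<beta>2 * len i" "tau i + \<beta>1 * len i < \<tau>inf"
      "0 < tau i + \<beta>1 * len i"
      using cell_order[of i] tau_less[of "Suc i"] tau_nonneg[of i] by (auto simp: tau_Suc)
    then show "\<sigma> * tau i < s i" "s i < \<sigma> * (tau i + \<beta>2 * len i)" "s i < \<sigma> * \<tau>inf" "0 < s i"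
      using \<sigma> by (simp_all only: s_def mult_less_cancel_left_pos zero_less_mult_iff) auto
  qed
  have sw: "switching_time u (s i)" for i
  proof -
    define \<epsilon> where "\<epsilon> = min (s i - \<sigma> * tau i) (\<sigma> * (tau i + \<beta>2 * len i) - s i)"
    have le: "\<sigma> * tau i \<le> s i - \<epsilon>" "s i + \<epsilon> \<le> \<sigma> * (tau i + \<beta>2 * len i)" and pos: "0 < \<epsilon>"
      using less[of i] by (auto simp: \<epsilon>_def)
    note ae = bang_cell_rescaled[OF \<sigma> v M, of i, folded s_def]
    have "AE t in lebesgue. s i - \<epsilon> < t \<and> t < s i \<longrightarrow> u t = M"
      using ae by eventually_elim (use le in auto)
    moreover have "AE t in lebesgue. s i < t \<and> t < s i + \<epsilon> \<longrightarrow> u t = - M"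
      using ae by eventually_elim (use le in auto)
    moreover have "M \<noteq> - M" using M by simp
    ultimately show ?thesis
      using pos unfolding switching_time_def by blast
  qed
  have "s \<longlonglongrightarrow> \<sigma> * (\<tau>inf + \<beta>1 * 0)"
    unfolding s_def[abs_def] by (intro tendsto_intros tendsto_tau tendsto_len)
  moreover have "s i \<in> S - {\<sigma> * \<tau>inf}" for i
    using less[of i] sw[of i] by (auto simp: S_def)
  ultimately have "(\<sigma> * \<tau>inf) islimpt S"
    unfolding islimpt_sequential by auto
  moreover from this have "infinite S"
    using islimpt_finite by blast
  ultimately show ?thesis
    by (simp add: chattering_def S_def)
qed

end

text \<open>The control is prescribed pointwise for one optimal solution and almost everywhere for
  all of them, since changes on null sets preserve optimality as long as the bound is kept. The
  restriction \<open>s < tinf\<close> is needed because \<open>tinf\<close>, as a limit of junction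
  times, satisfies \<open>junction_time\<close> too. In the fourth component the drift
  \<open>M3 * t i\<close> leaves a remainder of order \<open>\<alpha> ^ i\<close>, whereas the
  accumulated cost leaves one of order \<open>\<alpha> ^ (4 * i)\<close>; the last summand of its
  formula accounts for the difference.\<close>

theorem theorem5:
  fixes M0 M3 x01 x04 xf4 \<alpha> \<tau>1 \<tau>inf \<beta>1 \<beta>2 \<beta>3 tinf xinf4 :: real
    and \<tau> t :: "nat \<Rightarrow> real"
  assumes M0: "0 < M0" and M3: "0 < M3" and x01: "x01 < 0"
    and constants: "chattering_constants \<alpha> \<tau>1 \<tau>inf \<beta>1 \<beta>2 \<beta>3"
    and threshold:
      "xf4 - x04 \<ge> - (x01 / M0) * (x01 ^ 3 / M0 ^ 2 * R_opt_value + M3 * \<tau>inf)"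
  defines "\<tau> \<equiv> \<lambda>i. (1 - \<alpha> ^ i) / (1 - \<alpha>) * \<tau>1"
    and "t \<equiv> \<lambda>i. - (x01 / M0) * \<tau> i"
    and "tinf \<equiv> - (x01 / M0) * \<tau>inf"
    and "xinf4 \<equiv> x04 - x01 / M0 * (x01 ^ 3 / M0 ^ 2 * R_opt_value + M3 * \<tau>inf)"
  shows
    "0 < tinf \<and> t \<longlonglongrightarrow> tinf \<and>
     (\<exists>x u tf. Q_optimal M0 M3 x01 x04 xf4 x u tf \<and>
        (\<forall>i\<ge>1. \<forall>\<beta>.
           (\<beta> \<in> {0<..<\<beta>1} \<longrightarrow> u ((1 - \<beta>) * t (i - 1) + \<beta> * t i) = M0) \<and>
           (\<beta> \<in> {\<beta>1<..<\<beta>2} \<longrightarrow> u ((1 - \<beta>) * t (i - 1) + \<beta> * t i) = - M0) \<and>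
           (\<beta> \<in> {\<beta>2<..<1} \<longrightarrow> u ((1 - \<beta>) * t (i - 1) + \<beta> * t i) = M0)) \<and>
        (\<forall>s\<in>{tinf<..<tf}. u s = 0)) \<and>
     (\<forall>x u tf. Q_optimal M0 M3 x01 x04 xf4 x u tf \<longrightarrow>
        chattering u tinf \<and>
        {s. junction_time M3 x tf s \<and> s < tinf} = range t \<and>
        (\<forall>i. x (t i) $ 1 = \<alpha> ^ i * x01 \<and>
             x (t i) $ 2 = 0 \<and>
             x (t i) $ 3 = M3 \<and>
             x (t i) $ 4 = xinf4 - \<alpha> ^ (4 * i) * (xinf4 - x04)
                             - (\<alpha> ^ i - \<alpha> ^ (4 * i)) * M3 * tinf) \<and>
        x tinf = vector [0, 0, M3, xinf4] \<and>
        (\<forall>i\<ge>1. AE \<beta> in lebesgue.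
           (\<beta> \<in> {0<..<\<beta>1} \<longrightarrow> u ((1 - \<beta>) * t (i - 1) + \<beta> * t i) = M0) \<and>
           (\<beta> \<in> {\<beta>1<..<\<beta>2} \<longrightarrow> u ((1 - \<beta>) * t (i - 1) + \<beta> * t i) = - M0) \<and>
           (\<beta> \<in> {\<beta>2<..<1} \<longrightarrow> u ((1 - \<beta>) * t (i - 1) + \<beta> * t i) = M0)) \<and>
        (\<forall>s\<in>{tinf<..<tf}. x s $ 3 = M3) \<and>
        (AE s in lebesgue. s \<in> {tinf<..<tf} \<longrightarrow> u s = 0) \<and>
        tf = (xf4 - x04) / M3 + x01 ^ 4 * R_opt_value / (M0 ^ 3 * M3) \<and>
        tinf \<le> tf)"
proof -
  interpret chattering_system \<alpha> \<tau>1 \<tau>inf \<beta>1 \<beta>2 \<beta>3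
    by unfold_locales (rule constants)
  define \<sigma> where "\<sigma> = - (x01 / M0)"
  have \<sigma>: "0 < \<sigma>" using M0 x01 by (simp add: \<sigma>_def divide_neg_pos)
  have t_eq: "t i = \<sigma> * tau i" for i
    by (simp add: t_def \<tau>_def \<sigma>_def tau_def)
  have tinf_eq: "tinf = \<sigma> * \<tau>inf"
    by (simp add: tinf_def \<sigma>_def)
  have cube: "x01 / M0 * (x01 ^ 3 / M0 ^ 2 * R_opt_value) = x01^4 / M0^3 * R_opt_value"
    by (simp add: eval_nat_numeral)
  have xinf4_eq: "xinf4 = x04 + M3 * tinf - x01^4 / M0^3 * R_opt_value"
    unfolding xinf4_def tinf_def using cube by (simp add: algebra_simps)
  \<comment> \<open>Solves the terminal condition on the fourth component for the time, with cost
    \<open>R_opt_value\<close>. The threshold says exactly that this time is not before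
    \<open>tinf\<close>.\<close>
  define topt where "topt = (xf4 - x04) / M3 + x01 ^ 4 * R_opt_value / (M0 ^ 3 * M3)"
  have "M3 * tinf \<le> xf4 - x04 + x01^4 / M0^3 * R_opt_value"
    using threshold cube unfolding tinf_def by (simp add: algebra_simps)
  also have "\<dots> = M3 * topt"
    using M3 by (simp add: topt_def field_simps)
  finally have topt: "tinf \<le> topt"
    using M3 by simp
  have tinf_pos: "0 < tinf"
    using \<sigma> \<tau>inf_pos by (simp add: tinf_eq)
  have t_lim: "t \<longlonglongrightarrow> tinf"
    unfolding t_eq[abs_def] tinf_eq by (intro tendsto_intros tendsto_tau)

  obtain x' where feas: "Q_feasible M0 M3 x01 x04 xf4 x' (\<lambda>s. - M0 * vopt (s / \<sigma>)) topt"
    using Q_chattering_feasible[OF M0 M3 x01, of xf4 x04, folded \<sigma>_def, folded topt_def] topt tinf_eq by metis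
  have opt: "Q_optimal M0 M3 x01 x04 xf4 x' (\<lambda>s. - M0 * vopt (s / \<sigma>)) topt"
    unfolding Q_optimal_def using feas Q_feasible_cost[OF M0 M3 x01] by (auto simp: topt_def)
  have cell: "(1 - \<beta>) * t (i - 1) + \<beta> * t i = \<sigma> * (tau (i - 1) + \<beta> * len (i - 1))" if "i \<ge> 1" for i \<beta>
    using cell_affine[of \<beta> \<sigma> "i - 1"] that by (simp add: t_eq)
  have exact: "(\<beta> \<in> {0<..<\<beta>1} \<longrightarrow> - M0 * vopt (((1 - \<beta>) * t (i - 1) + \<beta> * t i) / \<sigma>) = M0) \<and>
      (\<beta> \<in> {\<beta>1<..<\<beta>2} \<longrightarrow> - M0 * vopt (((1 - \<beta>) * t (i - 1) + \<beta> * t i) / \<sigma>) = - M0) \<and>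
      (\<beta> \<in> {\<beta>2<..<1} \<longrightarrow> - M0 * vopt (((1 - \<beta>) * t (i - 1) + \<beta> * t i) / \<sigma>) = M0)"
    if i: "i \<ge> 1" for i \<beta>
  proof -
    have "\<sigma> * (tau (i - 1) + \<beta> * len (i - 1)) / \<sigma> = tau (i - 1) + \<beta> * len (i - 1)"
      using \<sigma> by simp
    then show ?thesis
      unfolding cell[OF i] using vopt_cell[of "i - 1" "tau (i - 1) + \<beta> * len (i - 1)"] len_pos[of "i - 1"] by auto
  qed
  have after: "- M0 * vopt (s / \<sigma>) = 0" if "s \<in> {tinf<..<topt}" for s
    using that \<sigma> vopt_after[of "s / \<sigma>"] by (simp add: tinf_eq field_simps)
  have part1: "\<exists>x u tf. Q_optimal M0 M3 x01 x04 xf4 x u tf \<and>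
        (\<forall>i\<ge>1. \<forall>\<beta>.
           (\<beta> \<in> {0<..<\<beta>1} \<longrightarrow> u ((1 - \<beta>) * t (i - 1) + \<beta> * t i) = M0) \<and>
           (\<beta> \<in> {\<beta>1<..<\<beta>2} \<longrightarrow> u ((1 - \<beta>) * t (i - 1) + \<beta> * t i) = - M0) \<and>
           (\<beta> \<in> {\<beta>2<..<1} \<longrightarrow> u ((1 - \<beta>) * t (i - 1) + \<beta> * t i) = M0)) \<and>
        (\<forall>s\<in>{tinf<..<tf}. u s = 0)"
    by (rule exI[of _ x'], rule exI[of _ "\<lambda>s. - M0 * vopt (s / \<sigma>)"], rule exI[of _ topt])
      (use opt exact after in blast)

  have part2: "chattering u tinf \<and>
        {s. junction_time M3 x tf s \<and> s < tinf} = range t \<and>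
        (\<forall>i. x (t i) $ 1 = \<alpha> ^ i * x01 \<and>
             x (t i) $ 2 = 0 \<and>
             x (t i) $ 3 = M3 \<and>
             x (t i) $ 4 = xinf4 - \<alpha> ^ (4 * i) * (xinf4 - x04)
                             - (\<alpha> ^ i - \<alpha> ^ (4 * i)) * M3 * tinf) \<and>
        x tinf = vector [0, 0, M3, xinf4] \<and>
        (\<forall>i\<ge>1. AE \<beta> in lebesgue.
           (\<beta> \<in> {0<..<\<beta>1} \<longrightarrow> u ((1 - \<beta>) * t (i - 1) + \<beta> * t i) = M0) \<and>
           (\<beta> \<in> {\<beta>1<..<\<beta>2} \<longrightarrow> u ((1 - \<beta>) * t (i - 1) + \<beta> * t i) = - M0) \<and>
           (\<beta> \<in> {\<beta>2<..<1} \<longrightarrow> u ((1 - \<beta>) * t (i - 1) + \<beta> * t i) = M0)) \<and>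
        (\<forall>s\<in>{tinf<..<tf}. x s $ 3 = M3) \<and>
        (AE s in lebesgue. s \<in> {tinf<..<tf} \<longrightarrow> u s = 0) \<and>
        tf = (xf4 - x04) / M3 + x01 ^ 4 * R_opt_value / (M0 ^ 3 * M3) \<and>
        tinf \<le> tf" if Q: "Q_optimal M0 M3 x01 x04 xf4 x u tf" for x u tf
  proof -
    have Qf: "Q_feasible M0 M3 x01 x04 xf4 x u tf" and "tf \<le> topt"
      using Q feas by (auto simp: Q_optimal_def)
    then have tf: "tf = topt"
      using Q_feasible_cost[OF M0 M3 x01 Qf] by (simp add: topt_def)
    define z z1 z2 v where "z = (\<lambda>s. (x (\<sigma> * s) $ 3 - M3) / (x01 * \<sigma>^2))"
      and "z1 = (\<lambda>s. x (\<sigma> * s) $ 2 / (x01 * \<sigma>))" and "z2 = (\<lambda>s. x (\<sigma> * s) $ 1 / x01)"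
      and "v = (\<lambda>s. - u (\<sigma> * s) / M0)"
    note r = Q_feasible_rescaled[OF M0 x01 Qf \<sigma>_def z_def z1_def z2_def v_def]
    have T: "\<tau>inf \<le> tf / \<sigma>" "0 \<le> tf"
      using topt tinf_pos \<sigma> unfolding tf tinf_eq by (auto simp: field_simps)
    \<comment> \<open>With \<open>tf = topt\<close> the terminal condition leaves no freedom for the
      cost, so the rescaled trajectory is optimal for (R) and its control is determined.\<close>
    have "x01^4 / M0^3 * integral {0..tf / \<sigma>} z = x01^4 / M0^3 * Jopt"
    proof -
      have "x tf $ 4 = xf4" using Qf by (simp add: Q_feasible_def vector_4)
      moreover have "M3 * tf = xf4 - x04 + x01^4 / M0^3 * Jopt"
        using M3 by (simp add: tf topt_def R_opt_value_eq field_simps)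
      ultimately show ?thesis
        using r(10)[of tf] T by auto
    qed
    then have J: "integral {0..tf / \<sigma>} z = Jopt"
      using M0 x01 by simp
    note fin = finite_horizon_optimal[OF r(1-4) T(1) r(8,9) J]
    have bang: "bang_cell (tau i) (len i) v" for i
      by (rule fin(1))
    have tT: "tau i \<le> tf / \<sigma>" for i
      using tau_less[of i] T by simp
    have xs: "x s $ 1 = x01 * z2 (s / \<sigma>)" "x s $ 2 = x01 * \<sigma> * z1 (s / \<sigma>)" "x s $ 3 = M3 + x01 * \<sigma>^2 * z (s / \<sigma>)" for s
      using \<sigma> x01 by (simp_all add: z_def z1_def z2_def)
    have st: "z (tau i) = 0" "z1 (tau i) = 0" "z2 (tau i) = \<alpha> ^ i" for i
      using bang_cells_state[OF r(1-4) tT bang] by auto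
    have tdiv: "t i / \<sigma> = tau i" "tinf / \<sigma> = \<tau>inf" for i
      using \<sigma> by (simp_all add: t_eq tinf_eq)
    have t_tf: "t i \<in> {0..tf}" "t i < tinf" for i
      using tT[of i] tau_nonneg[of i] tau_less[of i] \<sigma> by (auto simp: t_eq tinf_eq field_simps)
    have x3_le: "x s $ 3 \<le> M3" if "s \<in> {0..tf}" for s
      using Qf that by (simp add: Q_feasible_def)

    have "chattering u tinf"
      unfolding tinf_eq by (rule bang_cells_chattering[OF \<sigma> bang[unfolded v_def] M0])
    moreover have "{s. junction_time M3 x tf s \<and> s < tinf} = range t"
    proof -
      have x3c: "continuous_on {0..tf} (\<lambda>s. x s $ 3)"
        using Qf ac_primitive_continuous by (auto simp: Q_feasible_def)
      \<comment> \<open>By continuity the active set is closed, so a junction time is an active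
        point that is a limit of inactive ones. Before \<open>tinf\<close> the active points are the
        nodes, and each is the left end of an inactive open interval.\<close>
      have "closed {s \<in> {0..tf}. x s $ 3 = M3}"
        by (rule continuous_closed_preimage_constant[OF x3c]) simp
      then have jt: "junction_time M3 x tf s \<longleftrightarrow>
          s \<in> {0..tf} \<and> x s $ 3 = M3 \<and> s \<in> closure {s\<in>{0..tf}. x s $ 3 < M3}" for s
        by (simp add: junction_time_def closure_closed)
      have z0: "x s $ 3 = M3 \<longleftrightarrow> s \<in> range t" if s: "0 \<le> s" "s < tinf" for s
      proof -
        have "x s $ 3 = M3 \<longleftrightarrow> z (s / \<sigma>) = 0"
          using \<sigma> x01 by (simp add: xs)
        also have "\<dots> \<longleftrightarrow> s / \<sigma> \<in> range tau"
          by (rule bang_cells_nonneg(2)[OF r(1-4) T(1) bang]) (use s \<sigma> in \<open>auto simp: tinf_eq field_simps\<close>)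
        also have "\<dots> \<longleftrightarrow> s \<in> range t"
        proof -
          have "s / \<sigma> = tau i \<longleftrightarrow> s = t i" for i using \<sigma> by (auto simp: t_eq field_simps)
          then show ?thesis by auto
        qed
        finally show ?thesis .
      qed
      have smt: "strict_mono t"
        using strict_mono_tau \<sigma> by (simp add: strict_mono_def t_eq)
      have "t i \<in> closure {s\<in>{0..tf}. x s $ 3 < M3}" for i
      proof -
        have "t i < t (Suc i)" using smt by (simp add: strict_mono_def)
        moreover have "{t i<..<t (Suc i)} \<subseteq> {s\<in>{0..tf}. x s $ 3 < M3}"
        proof
          fix s assume s: "s \<in> {t i<..<t (Suc i)}"
          then have s': "s \<in> {0..tf}" "0 \<le> s" "s < tinf"
            using t_tf[of i] t_tf[of "Suc i"] by auto
          have "s \<notin> range t"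
          proof
            assume "s \<in> range t"
            then obtain j where "s = t j" by auto
            then have "i < j" "j < Suc i"
              using s strict_mono_less[OF smt] by auto
            then show False by simp
          qed
          then show "s \<in> {s\<in>{0..tf}. x s $ 3 < M3}"
            using z0[OF s'(2,3)] x3_le[OF s'(1)] s'(1) by auto
        qed
        ultimately show ?thesis
          using closure_mono closure_greaterThanLessThan[of "t i" "t (Suc i)"]
          by (metis atLeastAtMost_iff less_imp_le order_refl subsetD)
      qed
      then show ?thesis
        using z0 t_tf by (auto simp: jt)
    qed
    moreover have "\<forall>i. x (t i) $ 1 = \<alpha> ^ i * x01 \<and> x (t i) $ 2 = 0 \<and> x (t i) $ 3 = M3 \<and>
        x (t i) $ 4 = xinf4 - \<alpha> ^ (4 * i) * (xinf4 - x04) - (\<alpha> ^ i - \<alpha> ^ (4 * i)) * M3 * tinf"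
    proof (intro allI conjI)
      fix i
      show "x (t i) $ 1 = \<alpha> ^ i * x01" "x (t i) $ 2 = 0" "x (t i) $ 3 = M3"
        by (simp_all add: xs tdiv st)
      have "integral {0..tau i} z = (1 - \<alpha>^(4 * i)) * Jopt"
        by (rule bang_cells_cost[OF r(1-4) r(8) tT bang])
      then have x4: "x (t i) $ 4 = x04 + M3 * t i - (1 - \<alpha>^(4 * i)) * (x01^4 / M0^3 * R_opt_value)"
        using r(10)[OF t_tf(1)[of i]] by (simp add: tdiv R_opt_value_eq)
      have ti: "t i = (1 - \<alpha>^i) * tinf"
        by (simp add: t_eq tinf_eq tau_eq)
      have J4: "x01^4 / M0^3 * R_opt_value = x04 + M3 * tinf - xinf4"
        by (simp add: xinf4_eq)
      show "x (t i) $ 4 = xinf4 - \<alpha> ^ (4 * i) * (xinf4 - x04) - (\<alpha> ^ i - \<alpha> ^ (4 * i)) * M3 * tinf"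
        unfolding x4 J4 unfolding ti by (simp add: algebra_simps)
    qed
    moreover have "x tinf = vector [0, 0, M3, xinf4]"
    proof -
      have "integral {0..\<tau>inf} z = Jopt"
        by (rule bang_cells_total_cost[OF r(1-4) r(8) T(1) bang])
      then have "x tinf $ 4 = xinf4"
        using r(10)[of tinf] tinf_pos topt by (simp add: tf tdiv xinf4_eq R_opt_value_eq)
      then show ?thesis
        using bang_cells_final_state[OF r(1-4) T(1) bang]
        by (simp add: vec_eq_iff forall_4 vector_4 xs tdiv)
    qed
    moreover have "\<forall>i\<ge>1. AE \<beta> in lebesgue.
           (\<beta> \<in> {0<..<\<beta>1} \<longrightarrow> u ((1 - \<beta>) * t (i - 1) + \<beta> * t i) = M0) \<and>
           (\<beta> \<in> {\<beta>1<..<\<beta>2} \<longrightarrow> u ((1 - \<beta>) * t (i - 1) + \<beta> * t i) = - M0) \<and>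
           (\<beta> \<in> {\<beta>2<..<1} \<longrightarrow> u ((1 - \<beta>) * t (i - 1) + \<beta> * t i) = M0)"
    proof (intro allI impI)
      fix i :: nat assume i: "i \<ge> 1"
      show "AE \<beta> in lebesgue.
           (\<beta> \<in> {0<..<\<beta>1} \<longrightarrow> u ((1 - \<beta>) * t (i - 1) + \<beta> * t i) = M0) \<and>
           (\<beta> \<in> {\<beta>1<..<\<beta>2} \<longrightarrow> u ((1 - \<beta>) * t (i - 1) + \<beta> * t i) = - M0) \<and>
           (\<beta> \<in> {\<beta>2<..<1} \<longrightarrow> u ((1 - \<beta>) * t (i - 1) + \<beta> * t i) = M0)"
        unfolding cell[OF i] by (rule bang_cell_control[OF \<sigma> bang[unfolded v_def] M0])
    qed
    moreover have "\<forall>s\<in>{tinf<..<tf}. x s $ 3 = M3"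
    proof
      fix s assume "s \<in> {tinf<..<tf}"
      then have "z (s / \<sigma>) = 0"
        using \<sigma> by (intro fin(2)) (auto simp: tinf_eq field_simps)
      then show "x s $ 3 = M3"
        by (simp add: xs)
    qed
    moreover have "AE s in lebesgue. s \<in> {tinf<..<tf} \<longrightarrow> u s = 0"
    proof -
      have "1 / \<sigma> \<noteq> 0" using \<sigma> by simp
      moreover have "AE s in lebesgue. s \<in> {\<tau>inf<..<tf / \<sigma>} \<longrightarrow> v s = 0"
        by (rule fin(3))
      ultimately have "AE s in lebesgue. 0 + 1 / \<sigma> * s \<in> {\<tau>inf<..<tf / \<sigma>} \<longrightarrow> v (0 + 1 / \<sigma> * s) = 0"
        by (intro AE_lebesgue_affine[of "\<lambda>s. s \<in> {\<tau>inf<..<tf / \<sigma>} \<longrightarrow> v s = 0"])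
      then show ?thesis
        by eventually_elim (use \<sigma> M0 in \<open>auto simp: v_def tinf_eq field_simps\<close>)
    qed
    moreover have "tf = (xf4 - x04) / M3 + x01 ^ 4 * R_opt_value / (M0 ^ 3 * M3)" "tinf \<le> tf"
      using topt by (simp_all add: tf topt_def)
    ultimately show ?thesis
      by blast
  qed
  show ?thesis
    using tinf_pos t_lim part1 part2 by blast
qed

end
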